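(* Let $U$ be a model of $\mathrm{ZFU}_{\mathrm R}$ + DC-scheme, equipped with its definable classes. The following are equivalent. (1) $U \models$ "$\mathscr{A}$ is a set". (2) $U$ has a definable map (from classes to objects) that fulfills Basic Law V. (3) $U$ has a parametrically definable map (from classes to objects) that fulfills Basic Law V.
   Context: The language of urelement set theory has $\in$ and a unary predicate $\mathscr{A}$ for urelements; $\mathscr{A}$ also denotes the class of all urelements, and a set is an object that is not a urelement. $\mathrm{ZFU}_{\mathrm R}$ has the axioms: urelements have no members; Extensionality for sets (sets with the same members are equal); Foundation; Pairing; Union; Powerset; Infinity; the Separation schema; the Replacement schema. The urelements may form a proper class; "$\mathscr{A}$ is a set" means that some set has exactly the urelements as its members. The DC-scheme is the schema: for every formula $\varphi$ and parameter $u$, if for every $x$ there is some $y$ with $\varphi(x,y,u)$, then for every $p$ there is an infinite sequence $s$ (a function with domain $\omega$) such that $s(0)=p$ and $\varphi(s(n),s(n+1),u)$ for every $n<\omega$. Given a model $U$, its definable classes are the collections $\{x\in U: U\models\psi(x,z)\}$ with $\psi$ a first-order formula and $z\in U$ a parameter. "Equipped with definable classes" means that we consider the two-sorted structure whose objects are the elements of $U$ and whose classes are the definable classes. A map $X\mapsto\epsilon X$ from classes to objects is definable if its graph is defined over this structure by a second-order formula $\varphi(X,y)$ (quantifiers over objects and over definable classes allowed, no parameters), and parametrically definable if it is defined by a second-order formula $\varphi(X,y,P)$ with a definable class $P$ of $U$ as parameter. It fulfills Basic Law V if for all classes $X,Y$: $\epsilon X=\epsilon Y\leftrightarrow\forall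 x\,(x\in X\leftrightarrow x\in Y)$. *)

theory Defs
  imports Main
begin

text \<open>
  Structures for the language of urelement set theory. The domain is the whole type \<open>'a\<close>.
\<close>

record 'a ustruct =
  mem :: "'a \<Rightarrow> 'a \<Rightarrow> bool" (infix "\<epsilon>\<index>" 50)
  urel :: "'a \<Rightarrow> bool"


subsection \<open>First-order formulas and definable classes\<close>

text \<open>
  Variables are de Bruijn indices: inside a quantifier, index 0 is the bound variable and the
  surrounding indices are shifted by one. Correspondingly \<open>a \<cdot> e\<close> is the assignment that sends
  0 to \<open>a\<close> and \<open>Suc n\<close> to \<open>e n\<close>.
\<close>

abbreviation scons :: "'b \<Rightarrow> (nat \<Rightarrow> 'b) \<Rightarrow> nat \<Rightarrow> 'b" (infixr "\<cdot>" 65) where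
  "a \<cdot> e \<equiv> case_nat a e"

datatype fo =
    FMem nat nat
  | FEq nat nat
  | FUr nat
  | FNeg fo
  | FAnd fo fo
  | FAll fo

primrec fv :: "fo \<Rightarrow> nat set" where
  "fv (FMem i j) = {i, j}"
| "fv (FEq i j) = {i, j}"
| "fv (FUr i) = {i}"
| "fv (FNeg \<phi>) = fv \<phi>"
| "fv (FAnd \<phi> \<psi>) = fv \<phi> \<union> fv \<psi>"
| "fv (FAll \<phi>) = {n. Suc n \<in> fv \<phi>}"

primrec sat :: "'a ustruct \<Rightarrow> (nat \<Rightarrow> 'a) \<Rightarrow> fo \<Rightarrow> bool" where
  "sat U e (FMem i j) \<longleftrightarrow> e i \<epsilon>\<^bsub>U\<^esub> e j"
| "sat U e (FEq i j) \<longleftrightarrow> e i = e j"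
| "sat U e (FUr i) \<longleftrightarrow> urel U (e i)"
| "sat U e (FNeg \<phi>) \<longleftrightarrow> \<not> sat U e \<phi>"
| "sat U e (FAnd \<phi> \<psi>) \<longleftrightarrow> sat U e \<phi> \<and> sat U e \<psi>"
| "sat U e (FAll \<phi>) \<longleftrightarrow> (\<forall>a. sat U (a \<cdot> e) \<phi>)"

text \<open>
  In \<open>x \<cdot> (\<lambda>_. z)\<close> only the values at 0 and 1 matter, because of the condition on the free
  variables; the same device is used for the other formulas with a fixed list of arguments below.
\<close>

definition classes :: "'a ustruct \<Rightarrow> 'a set set" where
  "classes U = {X. \<exists>\<psi> z. fv \<psi> \<subseteq> {0, 1} \<and> X = {x. sat U (x \<cdot> (\<lambda>_. z)) \<psi>}}"


subsection \<open>Axioms of urelement set theory\<close>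

definition is_set :: "'a ustruct \<Rightarrow> 'a \<Rightarrow> bool" where
  "is_set U x \<longleftrightarrow> \<not> urel U x"

definition is_empty :: "'a ustruct \<Rightarrow> 'a \<Rightarrow> bool" where
  "is_empty U x \<longleftrightarrow> is_set U x \<and> (\<forall>y. \<not> y \<epsilon>\<^bsub>U\<^esub> x)"

definition is_upair :: "'a ustruct \<Rightarrow> 'a \<Rightarrow> 'a \<Rightarrow> 'a \<Rightarrow> bool" where
  "is_upair U p x y \<longleftrightarrow> is_set U p \<and> (\<forall>z. z \<epsilon>\<^bsub>U\<^esub> p \<longleftrightarrow> z = x \<or> z = y)"

definition is_pair :: "'a ustruct \<Rightarrow> 'a \<Rightarrow> 'a \<Rightarrow> 'a \<Rightarrow> bool" where
  "is_pair U p x y \<longleftrightarrow> (\<exists>a b. is_upair U a x x \<and> is_upair U b x y \<and> is_upair U p a b)"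

definition is_succ :: "'a ustruct \<Rightarrow> 'a \<Rightarrow> 'a \<Rightarrow> bool" where
  "is_succ U x y \<longleftrightarrow> is_set U y \<and> (\<forall>z. z \<epsilon>\<^bsub>U\<^esub> y \<longleftrightarrow> z \<epsilon>\<^bsub>U\<^esub> x \<or> z = x)"

definition is_inductive :: "'a ustruct \<Rightarrow> 'a \<Rightarrow> bool" where
  "is_inductive U w \<longleftrightarrow> is_set U w \<and> (\<exists>z. is_empty U z \<and> z \<epsilon>\<^bsub>U\<^esub> w) \<and>
     (\<forall>x. x \<epsilon>\<^bsub>U\<^esub> w \<longrightarrow> (\<exists>y. is_succ U x y \<and> y \<epsilon>\<^bsub>U\<^esub> w))"

definition is_omega :: "'a ustruct \<Rightarrow> 'a \<Rightarrow> bool" where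
  "is_omega U w \<longleftrightarrow> is_set U w \<and> (\<forall>x. x \<epsilon>\<^bsub>U\<^esub> w \<longleftrightarrow> (\<forall>v. is_inductive U v \<longrightarrow> x \<epsilon>\<^bsub>U\<^esub> v))"

text \<open>\<open>app U s x y\<close> says \<open>s(x) = y\<close> in \<open>U\<close>.\<close>

definition app :: "'a ustruct \<Rightarrow> 'a \<Rightarrow> 'a \<Rightarrow> 'a \<Rightarrow> bool" where
  "app U s x y \<longleftrightarrow> (\<exists>p. is_pair U p x y \<and> p \<epsilon>\<^bsub>U\<^esub> s)"

definition is_function_on :: "'a ustruct \<Rightarrow> 'a \<Rightarrow> 'a \<Rightarrow> bool" where
  "is_function_on U s d \<longleftrightarrow> is_set U s \<and>
     (\<forall>p. p \<epsilon>\<^bsub>U\<^esub> s \<longrightarrow> (\<exists>x y. x \<epsilon>\<^bsub>U\<^esub> d \<and> is_pair U p x y)) \<and>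
     (\<forall>x. x \<epsilon>\<^bsub>U\<^esub> d \<longrightarrow> (\<exists>!y. app U s x y))"

definition ax_urelements :: "'a ustruct \<Rightarrow> bool" where
  "ax_urelements U \<longleftrightarrow> (\<forall>x y. urel U x \<longrightarrow> \<not> y \<epsilon>\<^bsub>U\<^esub> x)"

definition ax_extensionality :: "'a ustruct \<Rightarrow> bool" where
  "ax_extensionality U \<longleftrightarrow>
     (\<forall>x y. is_set U x \<and> is_set U y \<and> (\<forall>z. z \<epsilon>\<^bsub>U\<^esub> x \<longleftrightarrow> z \<epsilon>\<^bsub>U\<^esub> y) \<longrightarrow> x = y)"

definition ax_foundation :: "'a ustruct \<Rightarrow> bool" where
  "ax_foundation U \<longleftrightarrow>
     (\<forall>x. (\<exists>y. y \<epsilon>\<^bsub>U\<^esub> x) \<longrightarrow> (\<exists>y. y \<epsilon>\<^bsub>U\<^esub> x \<and> \<not> (\<exists>z. z \<epsilon>\<^bsub>U\<^esub> y \<and> z \<epsilon>\<^bsub>U\<^esub> x)))"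

definition ax_pairing :: "'a ustruct \<Rightarrow> bool" where
  "ax_pairing U \<longleftrightarrow> (\<forall>x y. \<exists>p. is_upair U p x y)"

definition ax_union :: "'a ustruct \<Rightarrow> bool" where
  "ax_union U \<longleftrightarrow>
     (\<forall>x. is_set U x \<longrightarrow> (\<exists>v. is_set U v \<and> (\<forall>z. z \<epsilon>\<^bsub>U\<^esub> v \<longleftrightarrow> (\<exists>y. z \<epsilon>\<^bsub>U\<^esub> y \<and> y \<epsilon>\<^bsub>U\<^esub> x))))"

text \<open>
  Members of a power set are required to be sets, since urelements have no members and would
  otherwise count as subsets.
\<close>

definition ax_powerset :: "'a ustruct \<Rightarrow> bool" where
  "ax_powerset U \<longleftrightarrow>
     (\<forall>x. is_set U x \<longrightarrow> (\<exists>v. is_set U v \<and>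
        (\<forall>y. y \<epsilon>\<^bsub>U\<^esub> v \<longleftrightarrow> is_set U y \<and> (\<forall>z. z \<epsilon>\<^bsub>U\<^esub> y \<longrightarrow> z \<epsilon>\<^bsub>U\<^esub> x))))"

definition ax_infinity :: "'a ustruct \<Rightarrow> bool" where
  "ax_infinity U \<longleftrightarrow> (\<exists>w. is_inductive U w)"

text \<open>
  In the next two schemata the assignment \<open>e\<close> supplies the finitely many parameters of \<open>\<phi>\<close>.
\<close>

definition ax_separation :: "'a ustruct \<Rightarrow> bool" where
  "ax_separation U \<longleftrightarrow>
     (\<forall>\<phi> e x. is_set U x \<longrightarrow>
        (\<exists>v. is_set U v \<and> (\<forall>z. z \<epsilon>\<^bsub>U\<^esub> v \<longleftrightarrow> z \<epsilon>\<^bsub>U\<^esub> x \<and> sat U (z \<cdot> e) \<phi>)))"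

definition ax_replacement :: "'a ustruct \<Rightarrow> bool" where
  "ax_replacement U \<longleftrightarrow>
     (\<forall>\<phi> e w. is_set U w \<and> (\<forall>x. x \<epsilon>\<^bsub>U\<^esub> w \<longrightarrow> (\<exists>!y. sat U (x \<cdot> y \<cdot> e) \<phi>)) \<longrightarrow>
        (\<exists>v. is_set U v \<and> (\<forall>y. y \<epsilon>\<^bsub>U\<^esub> v \<longleftrightarrow> (\<exists>x. x \<epsilon>\<^bsub>U\<^esub> w \<and> sat U (x \<cdot> y \<cdot> e) \<phi>))))"

definition ZFU_R :: "'a ustruct \<Rightarrow> bool" where
  "ZFU_R U \<longleftrightarrow> ax_urelements U \<and> ax_extensionality U \<and> ax_foundation U \<and> ax_pairing U \<and>
     ax_union U \<and> ax_powerset U \<and> ax_infinity U \<and> ax_separation U \<and> ax_replacement U"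

text \<open>
  The sequence \<open>s\<close> is an element of \<open>U\<close>, and \<open>n < \<omega>\<close> ranges over the \<open>\<omega>\<close> of \<open>U\<close>, which need
  not be standard.
\<close>

definition DC_scheme :: "'a ustruct \<Rightarrow> bool" where
  "DC_scheme U \<longleftrightarrow>
     (\<forall>\<phi> u. fv \<phi> \<subseteq> {0, 1, 2} \<longrightarrow> (\<forall>x. \<exists>y. sat U (x \<cdot> y \<cdot> (\<lambda>_. u)) \<phi>) \<longrightarrow>
        (\<forall>p. \<exists>w s. is_omega U w \<and> is_function_on U s w \<and>
           (\<exists>z. is_empty U z \<and> app U s z p) \<and>
           (\<forall>n m x y. n \<epsilon>\<^bsub>U\<^esub> w \<and> is_succ U n m \<and> app U s n x \<and> app U s m y \<longrightarrow>
              sat U (x \<cdot> y \<cdot> (\<lambda>_. u)) \<phi>)))"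

definition urelements_form_set :: "'a ustruct \<Rightarrow> bool" where
  "urelements_form_set U \<longleftrightarrow> (\<exists>a. is_set U a \<and> (\<forall>x. x \<epsilon>\<^bsub>U\<^esub> a \<longleftrightarrow> urel U x))"


subsection \<open>Second-order formulas over the structure with its definable classes\<close>

text \<open>
  Object and class variables are indexed separately; \<open>SIn i k\<close> says that object \<open>i\<close> belongs to
  class \<open>k\<close>. Equality of classes is expressible by extensionality and so is not primitive.
\<close>

datatype so =
    SMem nat nat
  | SEq nat nat
  | SUr nat
  | SIn nat nat
  | SNeg so
  | SAnd so so
  | SAllObj so
  | SAllCls so

primrec ofv :: "so \<Rightarrow> nat set" where
  "ofv (SMem i j) = {i, j}"
| "ofv (SEq i j) = {i, j}"
| "ofv (SUr i) = {i}"
| "ofv (SIn i k) = {i}"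
| "ofv (SNeg \<phi>) = ofv \<phi>"
| "ofv (SAnd \<phi> \<psi>) = ofv \<phi> \<union> ofv \<psi>"
| "ofv (SAllObj \<phi>) = {n. Suc n \<in> ofv \<phi>}"
| "ofv (SAllCls \<phi>) = ofv \<phi>"

primrec cfv :: "so \<Rightarrow> nat set" where
  "cfv (SMem i j) = {}"
| "cfv (SEq i j) = {}"
| "cfv (SUr i) = {}"
| "cfv (SIn i k) = {k}"
| "cfv (SNeg \<phi>) = cfv \<phi>"
| "cfv (SAnd \<phi> \<psi>) = cfv \<phi> \<union> cfv \<psi>"
| "cfv (SAllObj \<phi>) = cfv \<phi>"
| "cfv (SAllCls \<phi>) = {k. Suc k \<in> cfv \<phi>}"

primrec sat2 :: "'a ustruct \<Rightarrow> (nat \<Rightarrow> 'a) \<Rightarrow> (nat \<Rightarrow> 'a set) \<Rightarrow> so \<Rightarrow> bool" where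
  "sat2 U e C (SMem i j) \<longleftrightarrow> e i \<epsilon>\<^bsub>U\<^esub> e j"
| "sat2 U e C (SEq i j) \<longleftrightarrow> e i = e j"
| "sat2 U e C (SUr i) \<longleftrightarrow> urel U (e i)"
| "sat2 U e C (SIn i k) \<longleftrightarrow> e i \<in> C k"
| "sat2 U e C (SNeg \<phi>) \<longleftrightarrow> \<not> sat2 U e C \<phi>"
| "sat2 U e C (SAnd \<phi> \<psi>) \<longleftrightarrow> sat2 U e C \<phi> \<and> sat2 U e C \<psi>"
| "sat2 U e C (SAllObj \<phi>) \<longleftrightarrow> (\<forall>a. sat2 U (a \<cdot> e) C \<phi>)"
| "sat2 U e C (SAllCls \<phi>) \<longleftrightarrow> (\<forall>X\<in>classes U. sat2 U e (X \<cdot> C) \<phi>)"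

text \<open>
  A map from classes to objects is represented by a function on all of \<open>'a set\<close>; its values
  outside \<open>classes U\<close> are ignored throughout.
\<close>

definition definable_map :: "'a ustruct \<Rightarrow> ('a set \<Rightarrow> 'a) \<Rightarrow> bool" where
  "definable_map U f \<longleftrightarrow>
     (\<exists>\<phi>. ofv \<phi> \<subseteq> {0} \<and> cfv \<phi> \<subseteq> {0} \<and>
        (\<forall>X\<in>classes U. \<forall>y. f X = y \<longleftrightarrow> sat2 U (\<lambda>_. y) (\<lambda>_. X) \<phi>))"

definition param_definable_map :: "'a ustruct \<Rightarrow> ('a set \<Rightarrow> 'a) \<Rightarrow> bool" where
  "param_definable_map U f \<longleftrightarrow>
     (\<exists>\<phi>. \<exists>P\<in>classes U. ofv \<phi> \<subseteq> {0} \<and> cfv \<phi> \<subseteq> {0, 1} \<and>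
        (\<forall>X\<in>classes U. \<forall>y. f X = y \<longleftrightarrow> sat2 U (\<lambda>_. y) (X \<cdot> (\<lambda>_. P)) \<phi>))"

definition basic_law_V :: "'a ustruct \<Rightarrow> ('a set \<Rightarrow> 'a) \<Rightarrow> bool" where
  "basic_law_V U f \<longleftrightarrow>
     (\<forall>X\<in>classes U. \<forall>Y\<in>classes U. f X = f Y \<longleftrightarrow> (\<forall>x. x \<in> X \<longleftrightarrow> x \<in> Y))"

end

theory Submission
  imports Defs
begin

text \<open>
  If the urelements form a set, a class is abstracted to the set of its least-ranked definitions
  (Scott's trick; the rank initial segments are sets exactly because the urelements are). Since
  satisfaction is not definable, a definition is an index into a stage \<open>n \<in> \<omega>\<close> of a hierarchy of
  families of classes, each stage being first-order definable from the previous one. Every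
  definable class occurs at a standard stage, so the least stage containing it exists, and a finite
  initial segment of the hierarchy is unique as a definable class by induction in \<open>U\<close>.

  If the urelements do not form a set, suppose a law is defined from a parameter \<open>p\<close>. Every definable
  permutation of urelements extends to an automorphism of \<open>U\<close>, and the law commutes with those fixing
  \<open>p\<close>. Dependent choice yields an infinite set of disjoint pairs \<open>(u, v)\<close> of urelements outside the
  support of \<open>p\<close>. Let \<open>X\<close> be the class of all sets of urelements differing finitely from the set
  of first components. Transpositions preserve \<open>X\<close>, so its value has support inside that of
  \<open>p\<close>; hence the value is also fixed when the components of all pairs are swapped at once, which does not
  preserve \<open>X\<close>.
\<close>

subsection \<open>First-order definability\<close>

text \<open>Seen from outside, \<open>U\<close> may be ill-founded and its \<omega> nonstandard, so
  induction inside \<open>U\<close> is available only for definable predicates and recursion only in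
  first-order form. This shapes everything below. Definability is tracked by closure rules.
  Recursion on sets is replaced by unions of set-sized simulations, and one such recursion serves
  both directions: it extends permutations of urelements to automorphisms, and it compares ranks.
  Foundation speaks of sets only, so \<in>-induction for definable predicates is extracted from
  dependent choice. The stages of definitions, by contrast, are counted outside \<open>U\<close>:
  each has its own formula, built from the preceding one. A formula for the map cannot mention them
  uniformly and instead quantifies over classes that tabulate the stages up to a given integer of
  \<open>U\<close>.\<close>

lemma scons_comp: "(\<lambda>i. E ((a \<cdot> r) i)) = E a \<cdot> (\<lambda>i. E (r i))"
  by (rule ext) (simp split: nat.split)

primrec ren :: "(nat \<Rightarrow> nat) \<Rightarrow> fo \<Rightarrow> fo" where
  "ren r (FMem i j) = FMem (r i) (r j)"
| "ren r (FEq i j) = FEq (r i) (r j)"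
| "ren r (FUr i) = FUr (r i)"
| "ren r (FNeg \<phi>) = FNeg (ren r \<phi>)"
| "ren r (FAnd \<phi> \<psi>) = FAnd (ren r \<phi>) (ren r \<psi>)"
| "ren r (FAll \<phi>) = FAll (ren (0 \<cdot> (\<lambda>i. Suc (r i))) \<phi>)"

lemma sat_ren: "sat U e (ren r \<phi>) \<longleftrightarrow> sat U (\<lambda>i. e (r i)) \<phi>"
  by (induction \<phi> arbitrary: e r) (simp_all add: scons_comp cong del: nat.case_cong_weak)

lemma fv_ren: "fv (ren r \<phi>) \<subseteq> range r"
proof (induction \<phi> arbitrary: r)
  case (FAll \<phi>)
  have "n \<in> range r" if "Suc n \<in> fv (ren (0 \<cdot> (\<lambda>i. Suc (r i))) \<phi>)" for n
    using FAll[of "0 \<cdot> (\<lambda>i. Suc (r i))"] that by (fastforce split: nat.splits)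
  then show ?case by auto
qed auto

text \<open>Definability is stated for predicates on assignments, so that closure rules produce the
  formula and no de Bruijn formula has to be written out.\<close>

definition pure_def :: "'a ustruct \<Rightarrow> ((nat \<Rightarrow> 'a) \<Rightarrow> bool) \<Rightarrow> bool" where
  "pure_def U P \<longleftrightarrow> (\<exists>\<phi>. \<forall>e. sat U e \<phi> \<longleftrightarrow> P e)"

lemma pure_mem: "pure_def U (\<lambda>e. e i \<epsilon>\<^bsub>U\<^esub> e j)"
  unfolding pure_def_def by (rule exI[of _ "FMem i j"]) simp

lemma pure_eq: "pure_def U (\<lambda>e. e i = e j)"
  unfolding pure_def_def by (rule exI[of _ "FEq i j"]) simp

lemma pure_ur: "pure_def U (\<lambda>e. urel U (e i))"
  unfolding pure_def_def by (rule exI[of _ "FUr i"]) simp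

lemma pure_neg: "pure_def U P \<Longrightarrow> pure_def U (\<lambda>e. \<not> P e)"
  unfolding pure_def_def by (metis sat.simps(4))

lemma pure_and: "pure_def U P \<Longrightarrow> pure_def U Q \<Longrightarrow> pure_def U (\<lambda>e. P e \<and> Q e)"
  unfolding pure_def_def by (metis sat.simps(5))

lemma pure_all:
  assumes "pure_def U (\<lambda>e. Q (\<lambda>i. e (Suc i)) (e 0))"
  shows "pure_def U (\<lambda>e. \<forall>x. Q e x)"
proof -
  obtain \<phi> where "\<And>e. sat U e \<phi> \<longleftrightarrow> Q (\<lambda>i. e (Suc i)) (e 0)"
    using assms unfolding pure_def_def by blast
  then have "\<forall>e. sat U e (FAll \<phi>) \<longleftrightarrow> (\<forall>x. Q e x)" by simp
  then show ?thesis unfolding pure_def_def by blast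
qed

lemma pure_or:
  assumes "pure_def U P" "pure_def U Q" shows "pure_def U (\<lambda>e. P e \<or> Q e)"
proof -
  have "pure_def U (\<lambda>e. \<not> (\<not> P e \<and> \<not> Q e))" by (intro pure_neg pure_and assms)
  then show ?thesis by simp
qed

lemma pure_imp:
  assumes "pure_def U P" "pure_def U Q" shows "pure_def U (\<lambda>e. P e \<longrightarrow> Q e)"
  unfolding imp_conv_disj by (intro pure_neg pure_or assms)

lemma pure_iff:
  assumes "pure_def U P" "pure_def U Q" shows "pure_def U (\<lambda>e. P e \<longleftrightarrow> Q e)"
  unfolding iff_conv_conj_imp by (intro pure_and pure_imp assms)

lemma pure_ex:
  assumes "pure_def U (\<lambda>e. Q (\<lambda>i. e (Suc i)) (e 0))"
  shows "pure_def U (\<lambda>e. \<exists>x. Q e x)"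
proof -
  have "pure_def U (\<lambda>e. \<not> (\<forall>x. \<not> Q e x))" by (intro pure_neg pure_all assms)
  then show ?thesis by simp
qed

lemmas pure_intros = pure_mem pure_eq pure_ur pure_neg pure_and pure_all pure_or pure_imp
  pure_iff pure_ex

lemma pure_ren: "pure_def U P \<Longrightarrow> pure_def U (\<lambda>e. P (\<lambda>i. e (r i)))"
  unfolding pure_def_def by (metis sat_ren)

lemma pure_pair: "pure_def U (\<lambda>e. is_pair U (e i) (e j) (e k))"
  unfolding is_pair_def is_upair_def is_set_def by (intro pure_intros)

text \<open>One parameter, at index 0, is enough because pairs code several. Pairing needs the
  axioms, so closure under conjunction has to wait for the locale of models.\<close>

definition param_def :: "'a ustruct \<Rightarrow> ((nat \<Rightarrow> 'a) \<Rightarrow> bool) \<Rightarrow> bool" where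
  "param_def U P \<longleftrightarrow> (\<exists>Q z. pure_def U Q \<and> (\<forall>e. P e \<longleftrightarrow> Q (z \<cdot> e)))"

text \<open>
  The only terms are variables and parameters. Stating the closure rules for \<open>param_def\<close> with terms
  lets \<open>intro\<close> prove definability of a formula with objects of the model as parameters.
\<close>

definition tm :: "((nat \<Rightarrow> 'a) \<Rightarrow> 'a) \<Rightarrow> bool" where
  "tm t \<longleftrightarrow> (\<exists>i. t = (\<lambda>e. e i)) \<or> (\<exists>c. t = (\<lambda>e. c))"

lemma tm_var: "tm (\<lambda>e. e i)" unfolding tm_def by blast
lemma tm_const: "tm (\<lambda>e. c)" unfolding tm_def by blast

lemma tm_ren: "tm t \<Longrightarrow> tm (\<lambda>e. t (\<lambda>i. e (r i)))"
  unfolding tm_def by auto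

lemma param_pure:
  assumes "pure_def U P" shows "param_def U P"
  using pure_ren[OF assms, of Suc] unfolding param_def_def by fastforce

lemma param_ren:
  assumes "param_def U P" shows "param_def U (\<lambda>e. P (\<lambda>i. e (r i)))"
proof -
  obtain Q z where Q: "pure_def U Q" "\<And>e. P e \<longleftrightarrow> Q (z \<cdot> e)"
    using assms unfolding param_def_def by blast
  have "pure_def U (\<lambda>e. Q (e 0 \<cdot> (\<lambda>i. e (Suc (r i)))))"
    using pure_ren[OF Q(1), of "0 \<cdot> (\<lambda>i. Suc (r i))"] by (simp add: scons_comp cong del: nat.case_cong_weak)
  then show ?thesis
    unfolding param_def_def using Q(2)
    by (intro exI[of _ "\<lambda>e. Q (e 0 \<cdot> (\<lambda>i. e (Suc (r i))))"] exI[of _ z]) auto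
qed

lemma param_neg: "param_def U P \<Longrightarrow> param_def U (\<lambda>e. \<not> P e)"
  unfolding param_def_def using pure_neg by fast

lemma param_all:
  assumes "param_def U (\<lambda>e. R (\<lambda>i. e (Suc i)) (e 0))"
  shows "param_def U (\<lambda>e. \<forall>x. R e x)"
proof -
  obtain Q z where Q: "pure_def U Q" "\<And>e. R (\<lambda>i. e (Suc i)) (e 0) \<longleftrightarrow> Q (z \<cdot> e)"
    using assms unfolding param_def_def by blast
  have R: "R e x \<longleftrightarrow> Q (z \<cdot> x \<cdot> e)" for e x using Q(2)[of "x \<cdot> e"] by simp
  \<comment> \<open>The bound variable must take index 0, which the parameter occupies in
    \<open>Q\<close>; the renaming exchanges the two.\<close>
  have "pure_def U (\<lambda>e. Q (e (Suc 0) \<cdot> e 0 \<cdot> (\<lambda>i. e (Suc (Suc i)))))"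
    using pure_ren[OF Q(1), of "Suc 0 \<cdot> 0 \<cdot> (\<lambda>i. Suc (Suc i))"] by (simp add: scons_comp cong del: nat.case_cong_weak)
  then have "pure_def U (\<lambda>e. \<forall>x. Q (e 0 \<cdot> x \<cdot> (\<lambda>i. e (Suc i))))"
    by (rule pure_all)
  then show ?thesis
    unfolding param_def_def R
    by (intro exI[of _ "\<lambda>e. \<forall>x. Q (e 0 \<cdot> x \<cdot> (\<lambda>i. e (Suc i)))"] exI[of _ z]) auto
qed

subsection \<open>Basic set theory in a model\<close>

locale zfu =
  fixes U :: "'a ustruct" (structure)
  assumes zfu: "ZFU_R U"
begin

lemma ur_empty: "urel U x \<Longrightarrow> \<not> y \<epsilon> x"
  using zfu unfolding ZFU_R_def ax_urelements_def by blast

lemma mem_is_set: "y \<epsilon> x \<Longrightarrow> is_set U x"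
  using ur_empty unfolding is_set_def by blast

lemma ext: "is_set U x \<Longrightarrow> is_set U y \<Longrightarrow> (\<And>z. z \<epsilon> x \<longleftrightarrow> z \<epsilon> y) \<Longrightarrow> x = y"
  using zfu unfolding ZFU_R_def ax_extensionality_def by blast

lemma foundation: "y \<epsilon> x \<Longrightarrow> \<exists>y. y \<epsilon> x \<and> (\<forall>z. z \<epsilon> y \<longrightarrow> \<not> z \<epsilon> x)"
  using zfu unfolding ZFU_R_def ax_foundation_def by meson

definition small :: "('a \<Rightarrow> bool) \<Rightarrow> bool" where
  "small P \<longleftrightarrow> (\<exists>v. is_set U v \<and> (\<forall>z. z \<epsilon> v \<longleftrightarrow> P z))"

definition st :: "('a \<Rightarrow> bool) \<Rightarrow> 'a" where
  "st P = (THE v. is_set U v \<and> (\<forall>z. z \<epsilon> v \<longleftrightarrow> P z))"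

lemma st_works: "small P \<Longrightarrow> is_set U (st P) \<and> (\<forall>z. z \<epsilon> st P \<longleftrightarrow> P z)"
  unfolding st_def small_def by (rule theI') (blast intro: ext)

lemma set_st: "small P \<Longrightarrow> is_set U (st P)"
  and mem_st: "small P \<Longrightarrow> z \<epsilon> st P \<longleftrightarrow> P z"
  using st_works by blast+

lemma small_mem: "is_set U x \<Longrightarrow> small (\<lambda>z. z \<epsilon> x)"
  unfolding small_def by blast

lemma small_cong: "(\<And>z. P z \<longleftrightarrow> Q z) \<Longrightarrow> small P \<Longrightarrow> small Q"
  unfolding small_def by simp

lemma small_upair: "small (\<lambda>z. z = x \<or> z = y)"
  using zfu unfolding ZFU_R_def ax_pairing_def is_upair_def small_def by blast

definition up :: "'a \<Rightarrow> 'a \<Rightarrow> 'a" where "up x y = st (\<lambda>z. z = x \<or> z = y)"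
definition pr :: "'a \<Rightarrow> 'a \<Rightarrow> 'a" where "pr x y = up (up x x) (up x y)"

lemma set_up: "is_set U (up x y)" and mem_up: "z \<epsilon> up x y \<longleftrightarrow> z = x \<or> z = y"
  unfolding up_def using set_st[OF small_upair] mem_st[OF small_upair] by blast+

lemma is_upair_iff: "is_upair U p x y \<longleftrightarrow> p = up x y"
  unfolding is_upair_def using set_up mem_up ext by metis

lemma is_pair_iff: "is_pair U p x y \<longleftrightarrow> p = pr x y"
  unfolding is_pair_def is_upair_iff pr_def by blast

lemma up_eq: "up x y = up x' y' \<longleftrightarrow> x = x' \<and> y = y' \<or> x = y' \<and> y = x'"
  (is "?l \<longleftrightarrow> ?r")
proof
  assume ?l
  then have "z = x \<or> z = y \<longleftrightarrow> z = x' \<or> z = y'" for z using mem_up by metis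
  then show ?r by metis
next
  assume ?r
  then have "z = x \<or> z = y \<longleftrightarrow> z = x' \<or> z = y'" for z by metis
  then show ?l unfolding up_def by presburger
qed

lemma pr_eq [simp]: "pr x y = pr x' y' \<longleftrightarrow> x = x' \<and> y = y'"
  unfolding pr_def up_eq by blast

text \<open>The ordered pair of both parameters becomes the only parameter, and the formula recovers
  its components by quantification. Conjunctions and substituted constants reduce to this.\<close>

lemma param_ex_pair:
  assumes "pure_def U Q" "\<And>e. P e \<longleftrightarrow> Q (z1 \<cdot> z2 \<cdot> e)"
  shows "param_def U P"
proof -
  have "pure_def U (\<lambda>e. Q (e (Suc 0) \<cdot> e 0 \<cdot> (\<lambda>i. e (Suc (Suc (Suc i))))))"
    using pure_ren[OF assms(1), of "Suc 0 \<cdot> 0 \<cdot> (\<lambda>i. Suc (Suc (Suc i)))"] by (simp add: scons_comp cong del: nat.case_cong_weak)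
  then have "pure_def U (\<lambda>e. \<exists>a b. is_pair U (e 0) a b \<and> Q (a \<cdot> b \<cdot> (\<lambda>i. e (Suc i))))"
    by (intro pure_ex pure_and pure_pair)
  then show ?thesis
    unfolding param_def_def is_pair_iff using assms(2)
    by (intro exI[of _ "\<lambda>e. \<exists>a b. e 0 = pr a b \<and> Q (a \<cdot> b \<cdot> (\<lambda>i. e (Suc i)))"]
        exI[of _ "pr z1 z2"]) auto
qed

lemma param_subst_const:
  assumes "param_def U P" shows "param_def U (\<lambda>e. P (c \<cdot> e))"
proof -
  obtain Q z where Q: "pure_def U Q" "\<And>e. P e \<longleftrightarrow> Q (z \<cdot> e)"
    using assms unfolding param_def_def by blast
  show ?thesis by (rule param_ex_pair[OF Q(1)]) (rule Q(2))
qed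

lemma param_and:
  assumes "param_def U P" "param_def U R" shows "param_def U (\<lambda>e. P e \<and> R e)"
proof -
  obtain Q z where Q: "pure_def U Q" "\<And>e. P e \<longleftrightarrow> Q (z \<cdot> e)"
    using assms unfolding param_def_def by blast
  obtain S y where S: "pure_def U S" "\<And>e. R e \<longleftrightarrow> S (y \<cdot> e)"
    using assms unfolding param_def_def by blast
  have "pure_def U (\<lambda>e. Q (e 0 \<cdot> (\<lambda>i. e (Suc (Suc i)))) \<and> S (e (Suc 0) \<cdot> (\<lambda>i. e (Suc (Suc i)))))"
    using pure_and[OF pure_ren[OF Q(1), of "0 \<cdot> (\<lambda>i. Suc (Suc i))"]
        pure_ren[OF S(1), of "Suc 0 \<cdot> (\<lambda>i. Suc (Suc i))"]] by (simp add: scons_comp cong del: nat.case_cong_weak)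
  then show ?thesis by (rule param_ex_pair[of _ _ z y]) (simp add: Q(2) S(2))
qed

lemma param_subst_tm:
  assumes "param_def U P" "tm t" shows "param_def U (\<lambda>e. P (t e \<cdot> e))"
  using assms(2) unfolding tm_def
proof (elim disjE exE)
  fix i assume "t = (\<lambda>e. e i)"
  then show ?thesis using param_ren[OF assms(1), of "i \<cdot> (\<lambda>i. i)"] by (simp add: scons_comp cong del: nat.case_cong_weak)
next
  fix c assume "t = (\<lambda>e. c)"
  then show ?thesis using param_subst_const[OF assms(1), of c] by simp
qed

lemma param_sub1:
  assumes "param_def U (\<lambda>e. P (e 0))" "tm t" shows "param_def U (\<lambda>e. P (t e))"
  using param_subst_tm[OF assms] by simp

text \<open>Each substitution removes variable 0, so a term inserted early must be shifted past the
  variables that are still to be replaced.\<close>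

lemma param_sub2:
  assumes "param_def U (\<lambda>e. P (e 0) (e (Suc 0)))" "tm s" "tm t"
  shows "param_def U (\<lambda>e. P (s e) (t e))"
  using param_subst_tm[OF param_subst_tm[OF assms(1) tm_ren[OF assms(2), of Suc]] assms(3)] by simp

lemma param_sub3:
  assumes "param_def U (\<lambda>e. P (e 0) (e (Suc 0)) (e (Suc (Suc 0))))" "tm r" "tm s" "tm t"
  shows "param_def U (\<lambda>e. P (r e) (s e) (t e))"
  using param_subst_tm[OF param_subst_tm[OF param_subst_tm[OF assms(1)
    tm_ren[OF assms(2), of "\<lambda>i. Suc (Suc i)"]] tm_ren[OF assms(3), of Suc]] assms(4)] by simp

lemma param_mem: "tm s \<Longrightarrow> tm t \<Longrightarrow> param_def U (\<lambda>e. s e \<epsilon> t e)"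
  by (rule param_sub2) (intro param_pure pure_intros)

lemma param_eq: "tm s \<Longrightarrow> tm t \<Longrightarrow> param_def U (\<lambda>e. s e = t e)"
  by (rule param_sub2) (intro param_pure pure_intros)

lemma param_ur: "tm s \<Longrightarrow> param_def U (\<lambda>e. urel U (s e))"
  by (rule param_sub1) (intro param_pure pure_intros)

lemma param_or:
  assumes "param_def U P" "param_def U Q" shows "param_def U (\<lambda>e. P e \<or> Q e)"
proof -
  have "param_def U (\<lambda>e. \<not> (\<not> P e \<and> \<not> Q e))" by (intro param_neg param_and assms)
  then show ?thesis by simp
qed

lemma param_imp:
  assumes "param_def U P" "param_def U Q" shows "param_def U (\<lambda>e. P e \<longrightarrow> Q e)"
  unfolding imp_conv_disj by (intro param_neg param_or assms)

lemma param_iff: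
  assumes "param_def U P" "param_def U Q" shows "param_def U (\<lambda>e. P e \<longleftrightarrow> Q e)"
  unfolding iff_conv_conj_imp by (intro param_and param_imp assms)

lemma param_ex:
  assumes "param_def U (\<lambda>e. Q (\<lambda>i. e (Suc i)) (e 0))"
  shows "param_def U (\<lambda>e. \<exists>x. Q e x)"
proof -
  have "param_def U (\<lambda>e. \<not> (\<forall>x. \<not> Q e x))" by (intro param_neg param_all assms)
  then show ?thesis by simp
qed

lemma param_bool: "param_def U (\<lambda>e. b)"
  using param_eq[OF tm_var tm_var, of 0 0] param_neg[OF param_eq[OF tm_var tm_var, of 0 0]]
  by (cases b) simp_all

lemma param_set: "tm s \<Longrightarrow> param_def U (\<lambda>e. is_set U (s e))"
  unfolding is_set_def by (intro param_neg param_ur)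

lemma param_pair: "tm r \<Longrightarrow> tm s \<Longrightarrow> tm t \<Longrightarrow> param_def U (\<lambda>e. is_pair U (r e) (s e) (t e))"
  by (rule param_sub3) (intro param_pure pure_pair)

lemmas param_intros = tm_var tm_const param_mem param_eq param_ur param_set param_pair
  param_neg param_and param_all param_or param_imp param_iff param_ex param_bool

lemma param_pair_eq: "tm r \<Longrightarrow> tm s \<Longrightarrow> tm t \<Longrightarrow> param_def U (\<lambda>e. r e = pr (s e) (t e))"
  using param_pair unfolding is_pair_iff .

lemma param_succ: "tm r \<Longrightarrow> tm s \<Longrightarrow> param_def U (\<lambda>e. is_succ U (r e) (s e))"
  by (rule param_sub2) (unfold is_succ_def, intro param_intros)

lemma param_empty: "tm r \<Longrightarrow> param_def U (\<lambda>e. is_empty U (r e))"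
  by (rule param_sub1) (unfold is_empty_def, intro param_intros)

lemma param_unary:
  assumes "param_def U (\<lambda>e. P (e 0))"
  shows "\<exists>\<phi> z. fv \<phi> \<subseteq> {0, 1} \<and> (\<forall>x. P x \<longleftrightarrow> sat U (x \<cdot> (\<lambda>_. z)) \<phi>)"
proof -
  obtain Q z where Q: "pure_def U Q" "\<And>e. P (e 0) \<longleftrightarrow> Q (z \<cdot> e)"
    using assms unfolding param_def_def by blast
  obtain \<phi> where \<phi>: "\<And>e. Q e \<longleftrightarrow> sat U e \<phi>" using Q(1) unfolding pure_def_def by blast
  \<comment> \<open>Index 0 held the parameter, which moves to 1. All other indices may collapse to
    0 because the predicate reads only one of them.\<close>
  define r :: "nat \<Rightarrow> nat" where "r = 1 \<cdot> (\<lambda>_. 0)"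
  have "P x \<longleftrightarrow> sat U (x \<cdot> (\<lambda>_. z)) (ren r \<phi>)" for x
    using Q(2)[of "\<lambda>_. x"] by (simp add: \<phi> sat_ren r_def scons_comp cong del: nat.case_cong_weak)
  moreover have "fv (ren r \<phi>) \<subseteq> {0, 1}"
    using fv_ren[of r \<phi>] by (auto simp: r_def split: nat.splits)
  ultimately show ?thesis by blast
qed

lemma param_binary:
  assumes "param_def U (\<lambda>e. P (e 0) (e (Suc 0)))"
  shows "\<exists>\<phi> z. fv \<phi> \<subseteq> {0, 1, 2} \<and> (\<forall>x y. P x y \<longleftrightarrow> sat U (x \<cdot> y \<cdot> (\<lambda>_. z)) \<phi>)"
proof -
  obtain Q z where Q: "pure_def U Q" "\<And>e. P (e 0) (e (Suc 0)) \<longleftrightarrow> Q (z \<cdot> e)"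
    using assms unfolding param_def_def by blast
  obtain \<phi> where \<phi>: "\<And>e. Q e \<longleftrightarrow> sat U e \<phi>" using Q(1) unfolding pure_def_def by blast
  define r :: "nat \<Rightarrow> nat" where "r = 2 \<cdot> 0 \<cdot> (\<lambda>_. 1)"
  have "P x y \<longleftrightarrow> sat U (x \<cdot> y \<cdot> (\<lambda>_. z)) (ren r \<phi>)" for x y
    using Q(2)[of "x \<cdot> (\<lambda>_. y)"] by (simp add: \<phi> sat_ren r_def scons_comp numeral_2_eq_2 cong del: nat.case_cong_weak)
  moreover have "fv (ren r \<phi>) \<subseteq> {0, 1, 2}"
    using fv_ren[of r \<phi>] by (auto simp: r_def split: nat.splits)
  ultimately show ?thesis by blast
qed

lemma classes_iff: "X \<in> classes U \<longleftrightarrow> param_def U (\<lambda>e. e 0 \<in> X)"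
proof
  assume "X \<in> classes U"
  then obtain \<psi> z where X: "X = {x. sat U (x \<cdot> (\<lambda>_. z)) \<psi>}" unfolding classes_def by blast
  have "pure_def U (\<lambda>e. sat U e \<psi>)" unfolding pure_def_def by blast
  from pure_ren[OF this, of "1 \<cdot> (\<lambda>_. 0)"]
  have "pure_def U (\<lambda>e. sat U (e 1 \<cdot> (\<lambda>_. e 0)) \<psi>)" by (simp add: scons_comp cong del: nat.case_cong_weak)
  then show "param_def U (\<lambda>e. e 0 \<in> X)"
    unfolding param_def_def X
    by (intro exI[of _ "\<lambda>e. sat U (e 1 \<cdot> (\<lambda>_. e 0)) \<psi>"] exI[of _ z]) simp
next
  assume "param_def U (\<lambda>e. e 0 \<in> X)"
  then obtain \<phi> z where "fv \<phi> \<subseteq> {0, 1}" "\<forall>x. x \<in> X \<longleftrightarrow> sat U (x \<cdot> (\<lambda>_. z)) \<phi>"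
    using param_unary[of "\<lambda>x. x \<in> X"] by auto
  then show "X \<in> classes U" unfolding classes_def by blast
qed

lemma param_class: "X \<in> classes U \<Longrightarrow> tm s \<Longrightarrow> param_def U (\<lambda>e. s e \<in> X)"
  by (rule param_sub1) (simp add: classes_iff)

lemma exists_empty: "small (\<lambda>z. False)"
proof -
  obtain w where w: "is_set U w"
    using zfu unfolding ZFU_R_def ax_infinity_def is_inductive_def by blast
  then have "\<exists>v. is_set U v \<and> (\<forall>z. z \<epsilon> v \<longleftrightarrow> z \<epsilon> w \<and> sat U (z \<cdot> (\<lambda>_. w)) (FNeg (FEq 0 0)))"
    using zfu unfolding ZFU_R_def ax_separation_def by blast
  then show ?thesis unfolding small_def by simp
qed

text \<open>No \<open>is_set\<close> hypothesis on \<open>x\<close>: if \<open>x\<close> is a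
  urelement, the comprehension is empty.\<close>

lemma small_sep:
  assumes "param_def U (\<lambda>e. P (e 0))" shows "small (\<lambda>z. z \<epsilon> x \<and> P z)"
proof (cases "urel U x")
  case True
  then show ?thesis by (intro small_cong[OF _ exists_empty]) (use ur_empty in auto)
next
  case False
  obtain \<phi> z where "\<forall>x. P x \<longleftrightarrow> sat U (x \<cdot> (\<lambda>_. z)) \<phi>"
    using param_unary[OF assms] by auto
  then show ?thesis
    using zfu False unfolding ZFU_R_def ax_separation_def is_set_def small_def by presburger
qed

lemma small_subset:
  assumes "param_def U (\<lambda>e. P (e 0))" "\<And>z. P z \<Longrightarrow> z \<epsilon> x" shows "small P"
  by (rule small_cong[OF _ small_sep[OF assms(1), of x]]) (use assms(2) in blast)

lemma small_image:
  assumes R: "param_def U (\<lambda>e. R (e 0) (e (Suc 0)))"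
    and fn: "\<And>x y y'. x \<epsilon> w \<Longrightarrow> R x y \<Longrightarrow> R x y' \<Longrightarrow> y = y'"
  shows "small (\<lambda>y. \<exists>x. x \<epsilon> w \<and> R x y)"
proof -
  have d: "param_def U (\<lambda>e. \<exists>y. R (e 0) y)" by (intro param_intros param_sub2[OF R])
  \<comment> \<open>Replacement demands a value at every member, so \<open>w\<close> is first cut
    down to the domain of \<open>R\<close>.\<close>
  define w' where "w' = st (\<lambda>x. x \<epsilon> w \<and> (\<exists>y. R x y))"
  have w': "x \<epsilon> w' \<longleftrightarrow> x \<epsilon> w \<and> (\<exists>y. R x y)" for x
    unfolding w'_def by (rule mem_st[OF small_sep[OF d]])
  have s: "is_set U w'" unfolding w'_def by (rule set_st[OF small_sep[OF d]])
  obtain \<phi> z where \<phi>: "\<forall>x y. R x y \<longleftrightarrow> sat U (x \<cdot> y \<cdot> (\<lambda>_. z)) \<phi>"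
    using param_binary[OF R] by auto
  have "\<forall>x. x \<epsilon> w' \<longrightarrow> (\<exists>!y. R x y)" using w' fn by blast
  then have "\<exists>v. is_set U v \<and> (\<forall>y. y \<epsilon> v \<longleftrightarrow> (\<exists>x. x \<epsilon> w' \<and> R x y))"
    using zfu s unfolding ZFU_R_def ax_replacement_def by (simp add: \<phi>)
  then show ?thesis unfolding small_def w' by blast
qed

lemma small_Union: "small (\<lambda>z. \<exists>y. z \<epsilon> y \<and> y \<epsilon> x)"
proof (cases "urel U x")
  case True
  then show ?thesis by (intro small_cong[OF _ exists_empty]) (use ur_empty in auto)
next
  case False
  then show ?thesis
    using zfu unfolding ZFU_R_def ax_union_def is_set_def small_def by blast
qed

lemma small_un:
  assumes "small P" "small Q" shows "small (\<lambda>z. P z \<or> Q z)"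
  using small_cong[OF _ small_Union[of "up (st P) (st Q)"], of "\<lambda>z. P z \<or> Q z"]
    mem_up mem_st[OF assms(1)] mem_st[OF assms(2)] by metis

lemma small_eq: "small (\<lambda>z. z = x)"
  using small_upair[of x x] by simp

lemma small_Pow: "small (\<lambda>y. is_set U y \<and> (\<forall>z. z \<epsilon> y \<longrightarrow> z \<epsilon> x))"
proof (cases "urel U x")
  case True
  have "y = st (\<lambda>z. False) \<longleftrightarrow> is_set U y \<and> (\<forall>z. z \<epsilon> y \<longrightarrow> z \<epsilon> x)" for y
    using True ur_empty mem_st[OF exists_empty] set_st[OF exists_empty] ext by metis
  then show ?thesis by (rule small_cong) (rule small_eq)
next
  case False
  then show ?thesis
    using zfu unfolding ZFU_R_def ax_powerset_def is_set_def small_def by blast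
qed

lemma small_prod: "small (\<lambda>p. \<exists>a b. p = pr a b \<and> a \<epsilon> x \<and> b \<epsilon> y)"
proof -
  define s where "s = st (\<lambda>z. z \<epsilon> x \<or> z \<epsilon> y)"
  have s: "z \<epsilon> s \<longleftrightarrow> z \<epsilon> x \<or> z \<epsilon> y" for z
  proof (cases "urel U x \<or> urel U y")
    case True
    have "small (\<lambda>z. z \<epsilon> x \<or> z \<epsilon> y)"
    proof -
      have e: "small (\<lambda>z. z \<epsilon> v)" for v
        by (rule small_subset[of _ v]) (intro param_intros)
      show ?thesis by (rule small_un[OF e e])
    qed
    then show ?thesis unfolding s_def by (rule mem_st)
  next
    case False
    then show ?thesis unfolding s_def is_set_def[symmetric]
      by (metis mem_st small_un small_mem is_set_def)
  qed
  define P where "P u = st (\<lambda>y. is_set U y \<and> (\<forall>z. z \<epsilon> y \<longrightarrow> z \<epsilon> u))" for u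
  have P: "y \<epsilon> P u \<longleftrightarrow> is_set U y \<and> (\<forall>z. z \<epsilon> y \<longrightarrow> z \<epsilon> u)" for y u
    unfolding P_def by (rule mem_st[OF small_Pow])
  \<comment> \<open>A Kuratowski pair of members of \<open>s\<close> is a set of subsets of
    \<open>s\<close>.\<close>
  have "p \<epsilon> P (P s)" if "\<exists>a b. p = pr a b \<and> a \<epsilon> x \<and> b \<epsilon> y" for p
    using that unfolding P s pr_def by (auto simp: mem_up P s set_up)
  moreover have "param_def U (\<lambda>e. \<exists>a b. e 0 = pr a b \<and> a \<epsilon> x \<and> b \<epsilon> y)"
    by (intro param_intros param_pair_eq)
  ultimately show ?thesis by (rule small_subset[rotated])
qed

lemma small_members: "small (\<lambda>z. z \<epsilon> x)"
  by (rule small_subset[of _ x]) (intro param_intros)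

lemma not_mem_self: "\<not> x \<epsilon> x"
  using foundation[of x "up x x"] by (auto simp: mem_up)

lemma not_mem_cycle: "x \<epsilon> y \<Longrightarrow> \<not> y \<epsilon> x"
  using foundation[of x "up x y"] by (auto simp: mem_up)

section \<open>The natural numbers of the model\<close>

definition emp :: 'a where "emp = st (\<lambda>z. False)"
definition sc :: "'a \<Rightarrow> 'a" where "sc x = st (\<lambda>z. z \<epsilon> x \<or> z = x)"

lemma not_mem_emp [simp]: "\<not> z \<epsilon> emp" and set_emp: "is_set U emp"
  unfolding emp_def using mem_st[OF exists_empty] set_st[OF exists_empty] by auto

lemma is_empty_iff: "is_empty U z \<longleftrightarrow> z = emp"
  unfolding is_empty_def using ext[of z emp] set_emp by auto

lemma mem_sc: "z \<epsilon> sc x \<longleftrightarrow> z \<epsilon> x \<or> z = x" and set_sc: "is_set U (sc x)"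
  unfolding sc_def
  using mem_st[OF small_un[OF small_members small_eq]] set_st[OF small_un[OF small_members small_eq]]
  by auto

lemma is_succ_iff: "is_succ U x y \<longleftrightarrow> y = sc x"
  unfolding is_succ_def using ext[of y "sc x"] set_sc mem_sc by auto

lemma sc_eq [simp]: "sc x = sc y \<longleftrightarrow> x = y"
  using mem_sc not_mem_cycle by metis

lemma sc_neq_emp: "sc x \<noteq> emp"
  using mem_sc not_mem_emp by metis

definition N :: "'a \<Rightarrow> bool" where "N n \<longleftrightarrow> (\<forall>v. is_inductive U v \<longrightarrow> n \<epsilon> v)"

lemma param_N: "tm s \<Longrightarrow> param_def U (\<lambda>e. N (s e))"
  by (rule param_sub1) (unfold N_def is_inductive_def, intro param_intros param_empty param_succ)

lemma is_inductive_iff: "is_inductive U v \<longleftrightarrow> emp \<epsilon> v \<and> (\<forall>x. x \<epsilon> v \<longrightarrow> sc x \<epsilon> v)"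
  unfolding is_inductive_def is_empty_iff is_succ_iff using mem_is_set by blast

lemma N_emp: "N emp" and N_sc: "N n \<Longrightarrow> N (sc n)"
  unfolding N_def is_inductive_iff by blast+

lemma small_N: "small N"
proof -
  obtain w where w: "is_inductive U w" using zfu unfolding ZFU_R_def ax_infinity_def by blast
  show ?thesis
    by (rule small_subset[of _ w]) (intro param_N tm_var, use w in \<open>simp add: N_def\<close>)
qed

text \<open>Separation turns a definable \<open>P\<close> into a set, which is inductive and so
  contains every integer of \<open>U\<close>. An arbitrary \<open>P\<close> could fail at
  nonstandard integers.\<close>

lemma N_induct:
  assumes N: "N n" and P: "param_def U (\<lambda>e. P (e 0))" and "P emp" "\<And>n. N n \<Longrightarrow> P n \<Longrightarrow> P (sc n)"
  shows "P n"
proof -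
  have m: "z \<epsilon> st (\<lambda>x. x \<epsilon> st N \<and> P x) \<longleftrightarrow> N z \<and> P z" for z
    using mem_st[OF small_sep[OF P]] mem_st[OF small_N] by blast
  have "is_inductive U (st (\<lambda>x. x \<epsilon> st N \<and> P x))"
    unfolding is_inductive_iff m using assms(3,4) N_emp N_sc by blast
  then show ?thesis using N m unfolding N_def by blast
qed

lemma is_omega_iff: "is_omega U w \<longleftrightarrow> w = st N"
  unfolding is_omega_def N_def[symmetric]
  using ext[of w "st N"] set_st[OF small_N] mem_st[OF small_N] by auto

lemma N_trans: assumes "N n" shows "k \<epsilon> m \<Longrightarrow> m \<epsilon> n \<Longrightarrow> k \<epsilon> n"
proof -
  have "\<forall>m k. k \<epsilon> m \<longrightarrow> m \<epsilon> n \<longrightarrow> k \<epsilon> n"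
    by (rule N_induct[OF assms]) (intro param_intros, auto simp: mem_sc)
  then show "k \<epsilon> m \<Longrightarrow> m \<epsilon> n \<Longrightarrow> k \<epsilon> n" by blast
qed

lemma emp_le_N: "N n \<Longrightarrow> emp \<epsilon> n \<or> emp = n"
  by (rule N_induct[of n]) (assumption, intro param_intros, auto simp: mem_sc)

lemma sc_le_N: assumes "N n" shows "m \<epsilon> n \<Longrightarrow> sc m \<epsilon> n \<or> sc m = n"
proof -
  \<comment> \<open>The successor is expressed by \<open>is_succ\<close> because \<open>sc\<close>
    is not a term of the language.\<close>
  have "\<forall>m. m \<epsilon> n \<longrightarrow> (\<exists>k. is_succ U m k \<and> (k \<epsilon> n \<or> k = n))"
    by (rule N_induct[OF assms]) (intro param_intros param_succ, auto simp: mem_sc is_succ_iff)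
  then show "m \<epsilon> n \<Longrightarrow> sc m \<epsilon> n \<or> sc m = n" unfolding is_succ_iff by blast
qed

lemma N_linear:
  assumes "N m" "N n" shows "m \<epsilon> n \<or> m = n \<or> n \<epsilon> m"
  using assms(2)
proof (rule N_induct)
  show "param_def U (\<lambda>e. m \<epsilon> e 0 \<or> m = e 0 \<or> e 0 \<epsilon> m)" by (intro param_intros)
  show "m \<epsilon> emp \<or> m = emp \<or> emp \<epsilon> m" using emp_le_N[OF assms(1)] by blast
  fix n assume "m \<epsilon> n \<or> m = n \<or> n \<epsilon> m"
  then show "m \<epsilon> sc n \<or> m = sc n \<or> sc n \<epsilon> m"
    using sc_le_N[OF assms(1), of n] mem_sc by blast
qed

lemma app_iff: "app U s x y \<longleftrightarrow> pr x y \<epsilon> s"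
  unfolding app_def is_pair_iff by blast

lemma param_app: "tm r \<Longrightarrow> tm s \<Longrightarrow> tm t \<Longrightarrow> param_def U (\<lambda>e. app U (r e) (s e) (t e))"
  by (rule param_sub3) (unfold app_def, intro param_intros)

subsection \<open>Transitive closures and simulations\<close>

definition trans_set :: "'a \<Rightarrow> bool" where
  "trans_set t \<longleftrightarrow> (\<forall>x y. y \<epsilon> x \<longrightarrow> x \<epsilon> t \<longrightarrow> y \<epsilon> t)"

text \<open>The transitive closure of the singleton of \<open>x\<close>, as an intersection. It is
  first-order before any transitive set around \<open>x\<close> is known to exist; were there none,
  it would hold of everything.\<close>

definition in_tc :: "'a \<Rightarrow> 'a \<Rightarrow> bool" where
  "in_tc x w \<longleftrightarrow> (\<forall>t. trans_set t \<longrightarrow> x \<epsilon> t \<longrightarrow> w \<epsilon> t)"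

lemma param_trans_set: "tm s \<Longrightarrow> param_def U (\<lambda>e. trans_set (s e))"
  by (rule param_sub1) (unfold trans_set_def, intro param_intros)

lemma param_in_tc: "tm s \<Longrightarrow> tm t \<Longrightarrow> param_def U (\<lambda>e. in_tc (s e) (t e))"
  by (rule param_sub2) (unfold in_tc_def, intro param_intros param_trans_set)

lemma in_tc_self: "in_tc x x" and in_tc_mem: "in_tc x y \<Longrightarrow> z \<epsilon> y \<Longrightarrow> in_tc x z"
  unfolding in_tc_def trans_set_def by blast+

text \<open>Used twice: with a permutation of urelements in \<open>G\<close> and \<open>b\<close>
  true, it approximates an automorphism; with trivial \<open>G\<close> and \<open>b\<close> false,
  it approximates the comparison of ranks.\<close>

definition sim :: "('a \<Rightarrow> 'a \<Rightarrow> bool) \<Rightarrow> bool \<Rightarrow> 'a \<Rightarrow> bool" where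
  "sim G b f \<longleftrightarrow> (\<forall>x y. app U f x y \<longrightarrow> G x y \<and>
     (\<forall>x'. x' \<epsilon> x \<longrightarrow> (\<exists>y'. y' \<epsilon> y \<and> app U f x' y')) \<and>
     (b \<longrightarrow> (\<forall>y'. y' \<epsilon> y \<longrightarrow> (\<exists>x'. x' \<epsilon> x \<and> app U f x' y'))))"

text \<open>
  A relation given by recursion on both arguments, defined through set-sized approximations so that
  it is first-order definable; \<open>b\<close> switches the backward condition on.
\<close>

definition bis :: "('a \<Rightarrow> 'a \<Rightarrow> bool) \<Rightarrow> bool \<Rightarrow> 'a \<Rightarrow> 'a \<Rightarrow> bool" where
  "bis G b x y \<longleftrightarrow> (\<exists>f. sim G b f \<and> app U f x y)"

lemma param_bis:
  assumes "param_def U (\<lambda>e. G (e 0) (e (Suc 0)))" "tm s" "tm t"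
  shows "param_def U (\<lambda>e. bis G b (s e) (t e))"
  by (rule param_sub2[OF _ assms(2,3)])
    (unfold bis_def sim_def, intro param_intros param_app param_sub2[OF assms(1)])

end

section \<open>Consequences of dependent choice\<close>

locale zfu_dc = zfu +
  assumes dc: "DC_scheme U"
begin

text \<open>The values of the sequence are collected by Replacement and the indices forgotten. What
  remains of the order of \<omega> is that the values form a chain for \<open>S\<close>.\<close>

lemma dc_chain:
  assumes R: "param_def U (\<lambda>e. R (e 0) (e (Suc 0)))" and tot: "\<And>x. \<exists>y. R x y"
    and S: "param_def U (\<lambda>e. S (e 0) (e (Suc 0)))"
    and refl: "\<And>x. S x x" and trans: "\<And>x y z. S x y \<Longrightarrow> S y z \<Longrightarrow> S x z"
    and RS: "\<And>x y. R x y \<Longrightarrow> S x y"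
  obtains r where "p \<epsilon> r" "\<And>x. x \<epsilon> r \<Longrightarrow> \<exists>y. y \<epsilon> r \<and> R x y"
    "\<And>x y. x \<epsilon> r \<Longrightarrow> y \<epsilon> r \<Longrightarrow> S x y \<or> S y x"
proof -
  obtain \<phi> u where \<phi>: "fv \<phi> \<subseteq> {0, 1, 2}" "\<And>x y. R x y \<longleftrightarrow> sat U (x \<cdot> y \<cdot> (\<lambda>_. u)) \<phi>"
    using param_binary[OF R] by auto
  have "\<forall>x. \<exists>y. sat U (x \<cdot> y \<cdot> (\<lambda>_. u)) \<phi>" using tot unfolding \<phi>(2) by blast
  then have "\<exists>w s. is_omega U w \<and> is_function_on U s w \<and> (\<exists>z. is_empty U z \<and> app U s z p) \<and>
           (\<forall>n m x y. n \<epsilon> w \<and> is_succ U n m \<and> app U s n x \<and> app U s m y \<longrightarrow> R x y)"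
    using dc \<phi>(1) unfolding DC_scheme_def \<phi>(2) by blast
  then obtain s where fn: "is_function_on U s (st N)" and s0: "app U s emp p"
    and ss: "\<And>n x y. N n \<Longrightarrow> app U s n x \<Longrightarrow> app U s (sc n) y \<Longrightarrow> R x y"
    unfolding is_omega_iff is_empty_iff is_succ_iff using mem_st[OF small_N] by blast
  have ex: "\<exists>y. app U s n y" and un: "app U s n y \<Longrightarrow> app U s n y' \<Longrightarrow> y = y'" if "N n" for n y y'
    using fn that unfolding is_function_on_def mem_st[OF small_N] by blast+
  have sm: "small (\<lambda>y. \<exists>n. n \<epsilon> st N \<and> app U s n y)"
    by (rule small_image) (intro param_app tm_var tm_const, use un mem_st[OF small_N] in blast)
  define r where "r = st (\<lambda>y. \<exists>n. n \<epsilon> st N \<and> app U s n y)"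
  have r: "y \<epsilon> r \<longleftrightarrow> (\<exists>n. N n \<and> app U s n y)" for y
    using mem_st[OF sm] mem_st[OF small_N] unfolding r_def by blast
  \<comment> \<open>The induction runs in \<open>U\<close>, on the later index; this is where
    \<open>S\<close> has to be definable.\<close>
  have mono: "\<forall>m x y. m \<epsilon> n \<longrightarrow> app U s m x \<longrightarrow> app U s n y \<longrightarrow> S x y" if "N n" for n
    using that
  proof (rule N_induct)
    show "param_def U (\<lambda>e. \<forall>m x y. m \<epsilon> e 0 \<longrightarrow> app U s m x \<longrightarrow> app U s (e 0) y \<longrightarrow> S x y)"
      by (intro param_intros param_app param_sub2[OF S])
    fix n assume n: "N n" and IH: "\<forall>m x y. m \<epsilon> n \<longrightarrow> app U s m x \<longrightarrow> app U s n y \<longrightarrow> S x y"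
    show "\<forall>m x y. m \<epsilon> sc n \<longrightarrow> app U s m x \<longrightarrow> app U s (sc n) y \<longrightarrow> S x y"
    proof (intro allI impI)
      fix m x y assume m: "m \<epsilon> sc n" "app U s m x" "app U s (sc n) y"
      obtain z where z: "app U s n z" using ex n by blast
      have "S x z" using m IH z refl un[OF n] unfolding mem_sc by blast
      moreover have "S z y" using ss[OF n z m(3)] RS by blast
      ultimately show "S x y" by (rule trans)
    qed
  qed simp
  show thesis
  proof (rule that)
    show "p \<epsilon> r" using r s0 N_emp by blast
    show "\<exists>y. y \<epsilon> r \<and> R x y" if "x \<epsilon> r" for x using that r ss ex N_sc by metis
    show "S x y \<or> S y x" if "x \<epsilon> r" "y \<epsilon> r" for x y
      using that unfolding r using mono N_linear un refl by metis
  qed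
qed

text \<open>A counterexample has a counterexample among its members. Dependent choice along this
  relation, made total by demanding nothing where \<open>P\<close> holds, gives a set in which the
  counterexamples violate Foundation.\<close>

lemma eps_induct:
  assumes P: "param_def U (\<lambda>e. P (e 0))" and step: "\<And>x. (\<And>y. y \<epsilon> x \<Longrightarrow> P y) \<Longrightarrow> P x"
  shows "P x"
proof (rule ccontr)
  assume nP: "\<not> P x"
  have R: "param_def U (\<lambda>e. \<not> P (e 0) \<longrightarrow> e (Suc 0) \<epsilon> e 0 \<and> \<not> P (e (Suc 0)))"
    by (intro param_intros param_sub1[OF P])
  have tot: "\<exists>y. \<not> P x \<longrightarrow> y \<epsilon> x \<and> \<not> P y" for x using step[of x] by blast
  obtain r where r: "x \<epsilon> r" "\<And>x. x \<epsilon> r \<Longrightarrow> \<exists>y. y \<epsilon> r \<and> (\<not> P x \<longrightarrow> y \<epsilon> x \<and> \<not> P y)"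
    by (rule dc_chain[OF R tot, of "\<lambda>_ _. True"]) (auto intro: param_bool)
  have nP': "param_def U (\<lambda>e. \<not> P (e 0))" by (intro param_intros param_sub1[OF P])
  have m: "z \<epsilon> st (\<lambda>z. z \<epsilon> r \<and> \<not> P z) \<longleftrightarrow> z \<epsilon> r \<and> \<not> P z" for z
    by (rule mem_st[OF small_sep[OF nP']])
  show False using foundation[of x "st (\<lambda>z. z \<epsilon> r \<and> \<not> P z)"] r nP unfolding m by blast
qed

lemma ex_trans_set: "\<exists>t. trans_set t \<and> x \<epsilon> t"
proof (rule eps_induct[where P = "\<lambda>x. \<exists>t. trans_set t \<and> x \<epsilon> t"])
  show "param_def U (\<lambda>e. \<exists>t. trans_set t \<and> e 0 \<epsilon> t)" by (intro param_intros param_trans_set)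
  fix x assume IH: "\<And>y. y \<epsilon> x \<Longrightarrow> \<exists>t. trans_set t \<and> y \<epsilon> t"
  \<comment> \<open>Replacement needs a unique value, hence the least transitive set around
    \<open>z\<close> instead of some transitive set.\<close>
  define R where "R z v \<longleftrightarrow> is_set U v \<and> (\<forall>w. w \<epsilon> v \<longleftrightarrow> in_tc z w)" for z v
  have R: "param_def U (\<lambda>e. R (e 0) (e (Suc 0)))"
    unfolding R_def by (intro param_intros param_in_tc)
  have sm: "small (\<lambda>v. \<exists>z. z \<epsilon> x \<and> R z v)"
    by (rule small_image[OF R]) (auto simp: R_def intro: ext)
  define V where "V = st (\<lambda>v. \<exists>z. z \<epsilon> x \<and> R z v)"
  have V: "v \<epsilon> V \<longleftrightarrow> (\<exists>z. z \<epsilon> x \<and> R z v)" for v unfolding V_def by (rule mem_st[OF sm])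
  have exR: "\<exists>v. R z v" if z: "z \<epsilon> x" for z
  proof -
    obtain t where t: "trans_set t" "z \<epsilon> t" using IH z by blast
    have "small (in_tc z)"
      by (rule small_subset[of _ t]) (intro param_in_tc tm_var tm_const, use t in \<open>simp add: in_tc_def\<close>)
    then show ?thesis unfolding R_def small_def by blast
  qed
  have sm': "small (\<lambda>w. (\<exists>v. w \<epsilon> v \<and> v \<epsilon> V) \<or> w = x)" by (rule small_un[OF small_Union small_eq])
  define t where "t = st (\<lambda>w. (\<exists>v. w \<epsilon> v \<and> v \<epsilon> V) \<or> w = x)"
  have t: "w \<epsilon> t \<longleftrightarrow> (\<exists>z. z \<epsilon> x \<and> in_tc z w) \<or> w = x" for w
  proof -
    have "(\<exists>v. w \<epsilon> v \<and> v \<epsilon> V) \<longleftrightarrow> (\<exists>z. z \<epsilon> x \<and> in_tc z w)"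
    proof (intro iffI; elim exE conjE)
      fix v assume "w \<epsilon> v" "v \<epsilon> V"
      then show "\<exists>z. z \<epsilon> x \<and> in_tc z w" unfolding V R_def by blast
    next
      fix z assume z: "z \<epsilon> x" "in_tc z w"
      then obtain v where v: "R z v" using exR by blast
      then have "w \<epsilon> v" using z unfolding R_def by blast
      then show "\<exists>v. w \<epsilon> v \<and> v \<epsilon> V" using v z V by blast
    qed
    then show ?thesis unfolding t_def mem_st[OF sm'] by blast
  qed
  have "trans_set t" unfolding trans_set_def t using in_tc_self in_tc_mem by blast
  then show "\<exists>t. trans_set t \<and> x \<epsilon> t" using t by blast
qed

lemma small_tc: "small (in_tc x)"
proof -
  obtain t where t: "trans_set t" "x \<epsilon> t" using ex_trans_set by blast
  show ?thesis
    by (rule small_subset[of _ t]) (intro param_in_tc tm_var tm_const, use t in \<open>simp add: in_tc_def\<close>)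
qed

text \<open>Simulations satisfy the recursion locally, and therefore so does their union.
  Conversely, a pair that satisfies the recursion clause may be added to a simulation containing the
  pairs below it.\<close>

lemma bis_unfold:
  assumes G: "param_def U (\<lambda>e. G (e 0) (e (Suc 0)))"
  shows "bis G b x y \<longleftrightarrow> G x y \<and> (\<forall>x'. x' \<epsilon> x \<longrightarrow> (\<exists>y'. y' \<epsilon> y \<and> bis G b x' y')) \<and>
     (b \<longrightarrow> (\<forall>y'. y' \<epsilon> y \<longrightarrow> (\<exists>x'. x' \<epsilon> x \<and> bis G b x' y')))" (is "_ \<longleftrightarrow> ?r x y")
proof
  have unf: "?r x y" if xy: "bis G b x y" for x y
  proof -
    obtain f where f: "sim G b f" "app U f x y" using xy unfolding bis_def by blast
    then have "bis G b x' y'" if "app U f x' y'" for x' y' using that unfolding bis_def by blast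
    then show ?thesis using f(2) f(1)[unfolded sim_def, rule_format, OF f(2)] by blast
  qed
  show "?r x y" if "bis G b x y" using unf[OF that] .
  assume r: "?r x y"
  obtain t1 where t1: "trans_set t1" "x \<epsilon> t1" using ex_trans_set by blast
  obtain t2 where t2: "trans_set t2" "y \<epsilon> t2" using ex_trans_set by blast
  \<comment> \<open>The relation \<open>bis\<close> need not be a set. Restricting it to two
    transitive sets makes it one, and transitivity keeps the witnesses for members inside.\<close>
  have "small (\<lambda>p. \<exists>a c. p = pr a c \<and> a \<epsilon> t1 \<and> c \<epsilon> t2 \<and> (bis G b a c \<or> a = x \<and> c = y))"
    by (rule small_subset[of _ "st (\<lambda>p. \<exists>a c. p = pr a c \<and> a \<epsilon> t1 \<and> c \<epsilon> t2)"],
        intro param_intros param_pair_eq param_bis[OF G], unfold mem_st[OF small_prod], blast)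
  then obtain f where "\<And>p. p \<epsilon> f \<longleftrightarrow> (\<exists>a c. p = pr a c \<and> a \<epsilon> t1 \<and> c \<epsilon> t2 \<and> (bis G b a c \<or> a = x \<and> c = y))"
    unfolding small_def by blast
  then have f: "app U f a c \<longleftrightarrow> a \<epsilon> t1 \<and> c \<epsilon> t2 \<and> (bis G b a c \<or> a = x \<and> c = y)" for a c
    unfolding app_iff by simp
  have "sim G b f"
    unfolding sim_def f
  proof (intro allI impI)
    fix a c assume ac: "a \<epsilon> t1 \<and> c \<epsilon> t2 \<and> (bis G b a c \<or> a = x \<and> c = y)"
    then have "?r a c" using unf[of a c] r by blast
    moreover have "\<forall>a'. a' \<epsilon> a \<longrightarrow> a' \<epsilon> t1" "\<forall>c'. c' \<epsilon> c \<longrightarrow> c' \<epsilon> t2"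
      using t1 t2 ac unfolding trans_set_def by blast+
    ultimately show "G a c \<and>
      (\<forall>x'. x' \<epsilon> a \<longrightarrow> (\<exists>y'. y' \<epsilon> c \<and> x' \<epsilon> t1 \<and> y' \<epsilon> t2 \<and> (bis G b x' y' \<or> x' = x \<and> y' = y))) \<and>
      (b \<longrightarrow> (\<forall>y'. y' \<epsilon> c \<longrightarrow> (\<exists>x'. x' \<epsilon> a \<and> x' \<epsilon> t1 \<and> y' \<epsilon> t2 \<and> (bis G b x' y' \<or> x' = x \<and> y' = y))))"
      by blast
  qed
  then show "bis G b x y" unfolding bis_def using f t1 t2 by blast
qed

end

context zfu
begin

subsection \<open>Automorphisms induced by permutations of the urelements\<close>

text \<open>All automorphisms used below are involutions, so \<open>j\<close> serves as its own
  inverse.\<close>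

definition is_aut :: "('a \<Rightarrow> 'a) \<Rightarrow> bool" where
  "is_aut j \<longleftrightarrow> (\<forall>x. j (j x) = x) \<and> (\<forall>x y. j x \<epsilon> j y \<longleftrightarrow> x \<epsilon> y) \<and> (\<forall>x. urel U (j x) \<longleftrightarrow> urel U x)"

lemma is_autD:
  assumes "is_aut j"
  shows "j (j x) = x" "j x \<epsilon> j y \<longleftrightarrow> x \<epsilon> y" "urel U (j x) \<longleftrightarrow> urel U x"
  using assms unfolding is_aut_def by blast+

lemma mem_aut: assumes "is_aut j" shows "x \<epsilon> j y \<longleftrightarrow> j x \<epsilon> y"
  using is_autD[OF assms] by metis

lemma all_aut: assumes "is_aut j" shows "(\<forall>a. P (j a)) \<longleftrightarrow> (\<forall>a. P a)"
  using is_autD(1)[OF assms] by metis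

lemma aut_eq: assumes "is_aut j" shows "j x = j y \<longleftrightarrow> x = y"
  using is_autD(1)[OF assms] by metis

lemma scons_map: "j a \<cdot> (\<lambda>i. j (e i)) = (\<lambda>i. j ((a \<cdot> e) i))"
  by (rule HOL.ext) (simp split: nat.split)

lemma sat_aut: assumes j: "is_aut j" shows "sat U (\<lambda>i. j (e i)) \<phi> \<longleftrightarrow> sat U e \<phi>"
proof (induction \<phi> arbitrary: e)
  case (FAll \<phi>)
  have "sat U (j a \<cdot> (\<lambda>i. j (e i))) \<phi> \<longleftrightarrow> sat U (a \<cdot> e) \<phi>" for a
    unfolding scons_map by (rule FAll)
  then show ?case using all_aut[OF j, of "\<lambda>a. sat U (a \<cdot> (\<lambda>i. j (e i))) \<phi>"] by simp
qed (simp_all add: is_autD[OF j] aut_eq[OF j])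

lemma mem_image_aut: assumes "is_aut j" shows "x \<in> j ` X \<longleftrightarrow> j x \<in> X"
  using is_autD(1)[OF assms] by (metis image_iff)

text \<open>The image is defined by the same formula from the moved parameter, so \<open>j\<close>
  itself need not be definable. A class whose parameter is fixed is fixed as well.\<close>

lemma aut_definable_class:
  assumes "is_aut j"
  shows "j ` {x. sat U (x \<cdot> (\<lambda>_. z)) \<psi>} = {x. sat U (x \<cdot> (\<lambda>_. j z)) \<psi>}"
proof -
  have "sat U (j x \<cdot> (\<lambda>_. z)) \<psi> \<longleftrightarrow> sat U (x \<cdot> (\<lambda>_. j z)) \<psi>" for x
    using sat_aut[OF assms, of "x \<cdot> (\<lambda>_. j z)" \<psi>]
    unfolding scons_map[symmetric] is_autD(1)[OF assms] .
  then show ?thesis by (intro set_eqI) (simp only: mem_image_aut[OF assms] mem_Collect_eq)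
qed

lemma classes_aut: assumes "is_aut j" "X \<in> classes U" shows "j ` X \<in> classes U"
proof -
  obtain \<psi> z where "fv \<psi> \<subseteq> {0, 1}" "X = {x. sat U (x \<cdot> (\<lambda>_. z)) \<psi>}"
    using assms(2) unfolding classes_def by blast
  then show ?thesis using aut_definable_class[OF assms(1)] unfolding classes_def by blast
qed

lemma image_aut: assumes "is_aut j" shows "j ` j ` X = X"
  using mem_image_aut[OF assms] is_autD(1)[OF assms] by auto

lemma sat2_aut:
  assumes j: "is_aut j"
  shows "sat2 U (\<lambda>i. j (e i)) (\<lambda>k. j ` C k) \<phi> \<longleftrightarrow> sat2 U e C \<phi>"
proof (induction \<phi> arbitrary: e C)
  case (SAllObj \<phi>)
  have "sat2 U (j a \<cdot> (\<lambda>i. j (e i))) (\<lambda>k. j ` C k) \<phi> \<longleftrightarrow> sat2 U (a \<cdot> e) C \<phi>" for a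
    unfolding scons_map by (rule SAllObj)
  then show ?case
    using all_aut[OF j, of "\<lambda>a. sat2 U (a \<cdot> (\<lambda>i. j (e i))) (\<lambda>k. j ` C k) \<phi>"] by simp
next
  case (SAllCls \<phi>)
  have s: "sat2 U (\<lambda>i. j (e i)) (j ` X \<cdot> (\<lambda>k. j ` C k)) \<phi> \<longleftrightarrow> sat2 U e (X \<cdot> C) \<phi>" for X
    unfolding scons_map[of "image j"] by (rule SAllCls)
  \<comment> \<open>Taking images under \<open>j\<close> permutes the definable classes, so the
    quantifier may be reindexed.\<close>
  have "(\<forall>X\<in>classes U. sat2 U (\<lambda>i. j (e i)) (X \<cdot> (\<lambda>k. j ` C k)) \<phi>) \<longleftrightarrow>
    (\<forall>X\<in>classes U. sat2 U (\<lambda>i. j (e i)) (j ` X \<cdot> (\<lambda>k. j ` C k)) \<phi>)"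
    using classes_aut[OF j] image_aut[OF j] by metis
  then show ?case by (simp add: s)
next
  case (SIn i k)
  then show ?case using mem_image_aut[OF j] is_autD(1)[OF j] by simp
qed (simp_all add: is_autD[OF j] aut_eq[OF j])

lemma in_tc_aut:
  assumes j: "is_aut j" and w: "in_tc x w" shows "in_tc (j x) (j w)"
  unfolding in_tc_def
proof (intro allI impI)
  fix t assume t: "trans_set t" "j x \<epsilon> t"
  have "trans_set (j t)"
    unfolding trans_set_def mem_aut[OF j]
    using t(1) is_autD(2)[OF j] unfolding trans_set_def by blast
  moreover have "x \<epsilon> j t" using t(2) mem_aut[OF j] by blast
  ultimately have "w \<epsilon> j t" using w unfolding in_tc_def by blast
  then show "j w \<epsilon> t" unfolding mem_aut[OF j] .
qed

lemma in_tc_trans: "in_tc x y \<Longrightarrow> in_tc y z \<Longrightarrow> in_tc x z"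
  unfolding in_tc_def by blast

end

context zfu_dc
begin

text \<open>The automorphism is the bisimulation that follows \<sigma> on urelements. It is total
  and functional by \<in>-induction, and symmetric because \<sigma> is an involution there. Where
  all urelements below an object are fixed, the identity satisfies the same recursion.\<close>

lemma ex_aut:
  assumes S: "param_def U (\<lambda>e. \<sigma> (e 0) = e (Suc 0))"
    and inv: "\<And>u. urel U u \<Longrightarrow> \<sigma> (\<sigma> u) = u" and ur: "\<And>u. urel U u \<Longrightarrow> urel U (\<sigma> u)"
  obtains j where "is_aut j" "\<And>u. urel U u \<Longrightarrow> j u = \<sigma> u"
    "\<And>x. (\<And>u. in_tc x u \<Longrightarrow> urel U u \<Longrightarrow> \<sigma> u = u) \<Longrightarrow> j x = x"
proof -
  \<comment> \<open>The first clause separates urelements from the empty set, which has the same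
    members.\<close>
  define G where "G x y \<longleftrightarrow> (urel U x \<longleftrightarrow> urel U y) \<and> (urel U x \<longrightarrow> \<sigma> x = y)" for x y
  have G: "param_def U (\<lambda>e. G (e 0) (e (Suc 0)))"
    unfolding G_def by (intro param_intros param_sub2[OF S])
  define J where "J = bis G True"
  have pJ: "tm s \<Longrightarrow> tm t \<Longrightarrow> param_def U (\<lambda>e. J (s e) (t e))" for s t
    unfolding J_def by (rule param_bis[OF G])
  have J: "J x y \<longleftrightarrow> G x y \<and> (\<forall>x'. x' \<epsilon> x \<longrightarrow> (\<exists>y'. y' \<epsilon> y \<and> J x' y')) \<and>
     (\<forall>y'. y' \<epsilon> y \<longrightarrow> (\<exists>x'. x' \<epsilon> x \<and> J x' y'))" for x y
    using bis_unfold[OF G, of True x y] unfolding J_def by simp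
  have fn: "\<forall>y y'. J x y \<longrightarrow> J x y' \<longrightarrow> y = y'" for x
  proof (rule eps_induct[where P = "\<lambda>x. \<forall>y y'. J x y \<longrightarrow> J x y' \<longrightarrow> y = y'"])
    show "param_def U (\<lambda>e. \<forall>y y'. J (e 0) y \<longrightarrow> J (e 0) y' \<longrightarrow> y = y')" by (intro param_intros pJ)
    fix x assume IH: "\<And>z. z \<epsilon> x \<Longrightarrow> \<forall>y y'. J z y \<longrightarrow> J z y' \<longrightarrow> y = y'"
    have sub: "z \<epsilon> y'" if "J x y" "J x y'" "z \<epsilon> y" for y y' z
    proof -
      obtain w where w: "w \<epsilon> x" "J w z" using \<open>J x y\<close> \<open>z \<epsilon> y\<close> J[of x y] by blast
      then obtain z' where "z' \<epsilon> y'" "J w z'" using \<open>J x y'\<close> J[of x y'] by blast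
      then show ?thesis using IH[OF w(1)] w(2) by blast
    qed
    show "\<forall>y y'. J x y \<longrightarrow> J x y' \<longrightarrow> y = y'"
    proof (intro allI impI)
      fix y y' assume y: "J x y" "J x y'"
      then have g: "G x y" "G x y'" using J by blast+
      show "y = y'"
      proof (cases "urel U x")
        case True
        then show ?thesis using g unfolding G_def by simp
      next
        case False
        then show ?thesis using g sub[OF y] sub[OF y(2,1)] ext unfolding G_def is_set_def by blast
      qed
    qed
  qed
  have sym: "\<forall>y. J x y \<longrightarrow> J y x" for x
  proof (rule eps_induct[where P = "\<lambda>x. \<forall>y. J x y \<longrightarrow> J y x"])
    show "param_def U (\<lambda>e. \<forall>y. J (e 0) y \<longrightarrow> J y (e 0))" by (intro param_intros pJ)
    fix x assume IH: "\<And>z. z \<epsilon> x \<Longrightarrow> \<forall>y. J z y \<longrightarrow> J y z"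
    show "\<forall>y. J x y \<longrightarrow> J y x"
    proof (intro allI impI)
      fix y assume y: "J x y"
      then have "G x y" using J by blast
      then have "G y x" unfolding G_def using inv by auto
      moreover have "\<forall>y'. y' \<epsilon> y \<longrightarrow> (\<exists>x'. x' \<epsilon> x \<and> J y' x')"
        "\<forall>x'. x' \<epsilon> x \<longrightarrow> (\<exists>y'. y' \<epsilon> y \<and> J y' x')"
        using y J[of x y] IH by blast+
      ultimately show "J y x" using J[of y x] by blast
    qed
  qed
  have tot: "\<exists>y. J x y" for x
  proof (rule eps_induct[where P = "\<lambda>x. \<exists>y. J x y"])
    show "param_def U (\<lambda>e. \<exists>y. J (e 0) y)" by (intro param_intros pJ)
    fix x assume IH: "\<And>z. z \<epsilon> x \<Longrightarrow> \<exists>y. J z y"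
    show "\<exists>y. J x y"
    proof (cases "urel U x")
      case True
      then have "J x (\<sigma> x)" using J[of x "\<sigma> x"] ur ur_empty unfolding G_def by blast
      then show ?thesis ..
    next
      case False
      have "small (\<lambda>y. \<exists>z. z \<epsilon> x \<and> J z y)"
        by (rule small_image) (intro pJ tm_var, use fn in blast)
      then obtain y where y: "is_set U y" "\<And>z. z \<epsilon> y \<longleftrightarrow> (\<exists>w. w \<epsilon> x \<and> J w z)"
        unfolding small_def by blast
      have "J x y" using J[of x y] False y IH unfolding G_def is_set_def by blast
      then show ?thesis ..
    qed
  qed
  define j where "j x = (THE y. J x y)" for x
  have j: "j x = y \<longleftrightarrow> J x y" for x y
  proof -
    have "J x (j x)" unfolding j_def by (rule theI') (use fn tot in blast)
    then show ?thesis using fn by blast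
  qed
  have jj: "j (j x) = x" for x using sym j by blast
  have mem: "j x \<epsilon> j y" if "x \<epsilon> y" for x y
    using that j J[of y "j y"] by metis
  have "is_aut j"
    unfolding is_aut_def using jj mem j J G_def by metis
  moreover have "j u = \<sigma> u" if "urel U u" for u using that j J G_def by metis
  moreover have "(\<forall>u. in_tc x u \<longrightarrow> urel U u \<longrightarrow> \<sigma> u = u) \<longrightarrow> J x x" for x
  proof (rule eps_induct[where P = "\<lambda>x. (\<forall>u. in_tc x u \<longrightarrow> urel U u \<longrightarrow> \<sigma> u = u) \<longrightarrow> J x x"])
    show "param_def U (\<lambda>e. (\<forall>u. in_tc (e 0) u \<longrightarrow> urel U u \<longrightarrow> \<sigma> u = u) \<longrightarrow> J (e 0) (e 0))"
      by (intro param_intros pJ param_in_tc param_sub2[OF S])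
    fix x assume IH: "\<And>y. y \<epsilon> x \<Longrightarrow> (\<forall>u. in_tc y u \<longrightarrow> urel U u \<longrightarrow> \<sigma> u = u) \<longrightarrow> J y y"
    show "(\<forall>u. in_tc x u \<longrightarrow> urel U u \<longrightarrow> \<sigma> u = u) \<longrightarrow> J x x"
    proof
      assume f: "\<forall>u. in_tc x u \<longrightarrow> urel U u \<longrightarrow> \<sigma> u = u"
      have "G x x" unfolding G_def using f in_tc_self by blast
      moreover have "J y y" if "y \<epsilon> x" for y
        using IH[OF that] f in_tc_trans[OF in_tc_mem[OF in_tc_self that]] by blast
      ultimately show "J x x" using J[of x x] by blast
    qed
  qed
  ultimately show thesis using that j by blast
qed

subsection \<open>An infinite matching\<close>

text \<open>
  Tarski's notion of finiteness: every nonempty family has a member whose trace on \<open>F\<close> is maximal.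
  It makes the union of a strictly increasing sequence infinite without any reference to \<open>\<omega>\<close>.
\<close>

definition tfin :: "'a \<Rightarrow> bool" where
  "tfin F \<longleftrightarrow> (\<forall>g. (\<exists>x. x \<epsilon> g) \<longrightarrow> (\<exists>x. x \<epsilon> g \<and>
     (\<forall>y. y \<epsilon> g \<longrightarrow> (\<forall>u. u \<epsilon> x \<longrightarrow> u \<epsilon> F \<longrightarrow> u \<epsilon> y) \<longrightarrow> (\<forall>u. u \<epsilon> y \<longrightarrow> u \<epsilon> F \<longrightarrow> u \<epsilon> x))))"

lemma param_tfin: "tm s \<Longrightarrow> param_def U (\<lambda>e. tfin (s e))"
  by (rule param_sub1) (unfold tfin_def, intro param_intros)

lemma tfin_emp: "tfin emp" unfolding tfin_def by simp

text \<open>If some members of \<open>g\<close> contain \<open>a\<close>, a maximal trace on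
  \<open>F\<close> among those works, since any competitor contains \<open>a\<close> too. Otherwise
  \<open>a\<close> affects no trace.\<close>

lemma tfin_insert:
  assumes F: "tfin F" and F': "\<And>u. u \<epsilon> F' \<longleftrightarrow> u \<epsilon> F \<or> u = a"
  shows "tfin F'"
  unfolding tfin_def F'
proof (intro allI impI)
  fix g assume g: "\<exists>x. x \<epsilon> g"
  have "small (\<lambda>x. x \<epsilon> g \<and> a \<epsilon> x)" by (rule small_sep) (intro param_intros)
  then obtain g1 where g1: "\<And>x. x \<epsilon> g1 \<longleftrightarrow> x \<epsilon> g \<and> a \<epsilon> x" unfolding small_def by blast
  show "\<exists>x. x \<epsilon> g \<and> (\<forall>y. y \<epsilon> g \<longrightarrow> (\<forall>u. u \<epsilon> x \<longrightarrow> u \<epsilon> F \<or> u = a \<longrightarrow> u \<epsilon> y) \<longrightarrow>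
    (\<forall>u. u \<epsilon> y \<longrightarrow> u \<epsilon> F \<or> u = a \<longrightarrow> u \<epsilon> x))"
  proof (cases "\<exists>x. x \<epsilon> g1")
    case True
    then obtain x where x: "x \<epsilon> g1"
      "\<And>y. y \<epsilon> g1 \<Longrightarrow> \<forall>u. u \<epsilon> x \<longrightarrow> u \<epsilon> F \<longrightarrow> u \<epsilon> y \<Longrightarrow> \<forall>u. u \<epsilon> y \<longrightarrow> u \<epsilon> F \<longrightarrow> u \<epsilon> x"
      using F[unfolded tfin_def, THEN spec, THEN mp, OF True] by blast
    show ?thesis
    proof (intro exI[of _ x] conjI allI impI)
      show "x \<epsilon> g" using x(1) g1 by blast
      fix y u assume y: "y \<epsilon> g" "\<forall>u. u \<epsilon> x \<longrightarrow> u \<epsilon> F \<or> u = a \<longrightarrow> u \<epsilon> y" "u \<epsilon> y" "u \<epsilon> F \<or> u = a"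
      have "a \<epsilon> x" using x(1) g1 by blast
      then have "y \<epsilon> g1" using y g1 by blast
      then show "u \<epsilon> x" using x(2) y \<open>a \<epsilon> x\<close> by blast
    qed
  next
    case False
    obtain x where x: "x \<epsilon> g"
      "\<And>y. y \<epsilon> g \<Longrightarrow> \<forall>u. u \<epsilon> x \<longrightarrow> u \<epsilon> F \<longrightarrow> u \<epsilon> y \<Longrightarrow> \<forall>u. u \<epsilon> y \<longrightarrow> u \<epsilon> F \<longrightarrow> u \<epsilon> x"
      using F[unfolded tfin_def, THEN spec, THEN mp, OF g] by blast
    show ?thesis
    proof (intro exI[of _ x] conjI allI impI)
      show "x \<epsilon> g" using x(1) .
      fix y u assume y: "y \<epsilon> g" "\<forall>u. u \<epsilon> x \<longrightarrow> u \<epsilon> F \<or> u = a \<longrightarrow> u \<epsilon> y" "u \<epsilon> y" "u \<epsilon> F \<or> u = a"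
      then have "u \<noteq> a" using False g1 by blast
      then show "u \<epsilon> x" using x(2) y by blast
    qed
  qed
qed

definition near :: "'a \<Rightarrow> 'a set" where
  "near b = {x. is_set U x \<and> (\<forall>u. u \<epsilon> x \<longrightarrow> urel U u) \<and>
     (\<exists>F. tfin F \<and> (\<forall>u. \<not> u \<epsilon> F \<longrightarrow> (u \<epsilon> x \<longleftrightarrow> u \<epsilon> b)))}"

lemma near_class: "near b \<in> classes U"
  unfolding classes_iff near_def mem_Collect_eq by (intro param_intros param_tfin)

text \<open>Moving \<open>c\<close> and \<open>c'\<close> enlarges the exceptional set by at most
  these two, and two insertions preserve finiteness.\<close>

lemma near_aut:
  assumes j: "is_aut j" and fx: "\<And>u. urel U u \<Longrightarrow> u \<noteq> c \<Longrightarrow> u \<noteq> c' \<Longrightarrow> j u = u"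
    and b: "\<And>u. u \<epsilon> b \<Longrightarrow> urel U u"
  shows "j ` near b = near b"
proof -
  have "j x \<in> near b" if "x \<in> near b" for x
  proof -
    obtain F where x: "is_set U x" "\<And>u. u \<epsilon> x \<Longrightarrow> urel U u" and F: "tfin F" "\<And>u. \<not> u \<epsilon> F \<Longrightarrow> u \<epsilon> x \<longleftrightarrow> u \<epsilon> b"
      using \<open>x \<in> near b\<close> unfolding near_def by blast
    have "small (\<lambda>u. u \<epsilon> F \<or> u = d)" for F d by (rule small_un[OF small_members small_eq])
    then obtain F1 F2 where F1: "\<And>u. u \<epsilon> F1 \<longleftrightarrow> u \<epsilon> F \<or> u = c"
      and F2: "\<And>u. u \<epsilon> F2 \<longleftrightarrow> u \<epsilon> F1 \<or> u = c'" unfolding small_def by metis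
    have "tfin F2" using tfin_insert[OF tfin_insert[OF F(1) F1] F2] .
    moreover have "u \<epsilon> j x \<longleftrightarrow> u \<epsilon> b" if u: "\<not> u \<epsilon> F2" for u
    proof (cases "urel U u")
      case True
      then have "j u = u" using fx u F1 F2 by blast
      then show ?thesis using F(2)[of u] u F1 F2 mem_aut[OF j] by metis
    next
      case False
      then show ?thesis using b x(2) mem_aut[OF j] is_autD(3)[OF j] by blast
    qed
    moreover have "is_set U (j x)" using x(1) is_autD(3)[OF j] unfolding is_set_def by blast
    moreover have "\<forall>u. u \<epsilon> j x \<longrightarrow> urel U u" using x(2) mem_aut[OF j] is_autD(3)[OF j] by blast
    ultimately show ?thesis unfolding near_def by blast
  qed
  \<comment> \<open>One inclusion suffices because \<open>j\<close> is an involution.\<close>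
  then show ?thesis using mem_image_aut[OF j] is_autD(1)[OF j] by (metis set_eqI)
qed

lemma small_Union2: "small (\<lambda>u. \<exists>a q. u \<epsilon> a \<and> a \<epsilon> q \<and> q \<epsilon> x)"
  by (rule small_cong[OF _ small_Union[of "st (\<lambda>z. \<exists>y. z \<epsilon> y \<and> y \<epsilon> x)"]])
    (auto simp: mem_st[OF small_Union])

text \<open>Kuratowski pairs put the field of a relation into its double union. This bounds domains
  by a set and tells which urelements are already in use.\<close>

lemma app_Union2: "app U d u v \<Longrightarrow> \<exists>a q. u \<epsilon> a \<and> a \<epsilon> q \<and> q \<epsilon> d"
  and app_Union2': "app U d u v \<Longrightarrow> \<exists>a q. v \<epsilon> a \<and> a \<epsilon> q \<and> q \<epsilon> d"
  unfolding app_iff pr_def by (meson mem_up)+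

text \<open>\<open>K\<close> is the forbidden region, later the transitive closure of the parameter.
  As \<open>u \<noteq> v\<close>, the second clause also prevents a first component from being a
  second one.\<close>

definition matching :: "('a \<Rightarrow> bool) \<Rightarrow> ('a \<Rightarrow> 'a \<Rightarrow> bool) \<Rightarrow> bool" where
  "matching K M \<longleftrightarrow> (\<forall>u v. M u v \<longrightarrow> urel U u \<and> urel U v \<and> u \<noteq> v \<and> \<not> K u \<and> \<not> K v) \<and>
     (\<forall>u v u' v'. M u v \<longrightarrow> M u' v' \<longrightarrow> u = u' \<or> u = v' \<or> v = u' \<or> v = v' \<longrightarrow> u = u' \<and> v = v')"

lemma matching_inj:
  "matching K M \<Longrightarrow> M u v \<Longrightarrow> M u' v' \<Longrightarrow> u = u' \<or> u = v' \<or> v = u' \<or> v = v' \<Longrightarrow> u = u' \<and> v = v'"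
  unfolding matching_def by blast

lemma matchingD:
  "matching K M \<Longrightarrow> M u v \<Longrightarrow> urel U u \<and> urel U v \<and> u \<noteq> v \<and> \<not> K u \<and> \<not> K v"
  unfolding matching_def by blast

text \<open>Every appeal to the urelements being a proper class passes through here: no set-sized
  condition can exhaust them.\<close>

lemma fresh_urelement:
  assumes "\<not> urelements_form_set U" "small Q" obtains u where "urel U u" "\<not> Q u"
proof -
  have "\<exists>u. urel U u \<and> \<not> Q u"
  proof (rule ccontr)
    assume "\<not> ?thesis"
    then have "small (urel U)"
      by (intro small_subset[of _ "st Q"] param_intros) (use mem_st[OF assms(2)] in auto)
    then show False using assms(1) unfolding urelements_form_set_def small_def by blast
  qed
  then show thesis using that by blast
qed

text \<open>Dependent choice enlarges a set-sized matching by one fresh pair at a time;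
  \<open>M\<close> is the union of the resulting chain.\<close>

lemma ex_matching:
  assumes A: "\<not> urelements_form_set U" and K: "small K" "param_def U (\<lambda>e. K (e 0))"
  obtains M b where "param_def U (\<lambda>e. M (e 0) (e (Suc 0)))" "matching K M"
    "\<And>u. u \<epsilon> b \<longleftrightarrow> (\<exists>v. M u v)" "is_set U b" "\<And>F. tfin F \<Longrightarrow> \<exists>u. u \<epsilon> b \<and> \<not> u \<epsilon> F"
proof -
  define good where "good d \<longleftrightarrow> matching K (app U d)" for d
  have pgood: "tm s \<Longrightarrow> param_def U (\<lambda>e. good (s e))" for s
    by (rule param_sub1) (unfold good_def matching_def, intro param_intros param_app param_sub1[OF K(2)])
  define S where "S d d' \<longleftrightarrow> (\<forall>z. z \<epsilon> d \<longrightarrow> z \<epsilon> d')" for d d'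
  \<comment> \<open>Totality is needed on the whole universe, so nothing but inclusion is required
    of a \<open>d\<close> that is not good.\<close>
  define R where "R d d' \<longleftrightarrow> S d d' \<and>
    (good d \<longrightarrow> good d' \<and> (\<exists>u v. app U d' u v \<and> \<not> app U d u v))" for d d'
  have pS: "param_def U (\<lambda>e. S (e 0) (e (Suc 0)))" unfolding S_def by (intro param_intros)
  have pR: "param_def U (\<lambda>e. R (e 0) (e (Suc 0)))"
    unfolding R_def S_def by (intro param_intros pgood param_app)
  have tot: "\<exists>d'. R d d'" for d
  proof (cases "good d")
    case False
    then show ?thesis unfolding R_def S_def by blast
  next
    case True
    define Q where "Q z \<longleftrightarrow> K z \<or> (\<exists>a q. z \<epsilon> a \<and> a \<epsilon> q \<and> q \<epsilon> d)" for z
    have Q: "small Q" unfolding Q_def by (rule small_un[OF K(1) small_Union2])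
    obtain u where u: "urel U u" "\<not> Q u" by (rule fresh_urelement[OF A Q])
    obtain v where v: "urel U v" "\<not> (Q v \<or> v = u)"
      by (rule fresh_urelement[OF A small_un[OF Q small_eq]])
    obtain d' where d': "\<And>z. z \<epsilon> d' \<longleftrightarrow> z \<epsilon> d \<or> z = pr u v"
      using small_un[OF small_members[of d] small_eq[of "pr u v"]] unfolding small_def by blast
    have app': "app U d' x y \<longleftrightarrow> app U d x y \<or> x = u \<and> y = v" for x y
      unfolding app_iff d' by simp
    have new: "x \<noteq> u \<and> x \<noteq> v \<and> y \<noteq> u \<and> y \<noteq> v" if "app U d x y" for x y
      using app_Union2[OF that] app_Union2'[OF that] u v unfolding Q_def by blast
    have "good d'"
      using True u v new unfolding good_def matching_def app' Q_def by metis
    moreover have "app U d' u v" "\<not> app U d u v" using app' new by blast+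
    ultimately show ?thesis unfolding R_def S_def using d' by blast
  qed
  obtain r where r: "emp \<epsilon> r" "\<And>x. x \<epsilon> r \<Longrightarrow> \<exists>y. y \<epsilon> r \<and> R x y"
    "\<And>x y. x \<epsilon> r \<Longrightarrow> y \<epsilon> r \<Longrightarrow> S x y \<or> S y x"
    by (rule dc_chain[OF pR tot pS, of emp]) (auto simp: S_def R_def)
  define M where "M u v \<longleftrightarrow> (\<exists>d. d \<epsilon> r \<and> good d \<and> app U d u v)" for u v
  have pM: "param_def U (\<lambda>e. M (e 0) (e (Suc 0)))"
    unfolding M_def by (intro param_intros pgood param_app)
  \<comment> \<open>The chain puts both pairs into the larger of two good sets, so the matching
    conditions can be checked there.\<close>
  have common: "\<exists>d. good d \<and> app U d u v \<and> app U d u' v'" if ab: "M u v" "M u' v'" for u v u' v'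
  proof -
    obtain d d' where d: "d \<epsilon> r" "good d" "app U d u v" "d' \<epsilon> r" "good d'" "app U d' u' v'"
      using ab unfolding M_def by blast
    then show ?thesis using r(3)[of d d'] unfolding S_def app_iff by blast
  qed
  have mM: "matching K M"
    unfolding matching_def
  proof (intro conjI allI impI)
    fix u v u' v' assume uv: "M u v" "M u' v'" "u = u' \<or> u = v' \<or> v = u' \<or> v = v'"
    obtain d where "good d" "app U d u v" "app U d u' v'" using common[OF uv(1,2)] by blast
    then show "u = u'" "v = v'" using matching_inj uv(3) unfolding good_def by blast+
  next
    fix u v assume "M u v"
    then obtain d where "good d" "app U d u v" unfolding M_def by blast
    then show "urel U u" "urel U v" "u \<noteq> v" "\<not> K u" "\<not> K v"
      using matchingD unfolding good_def by blast+
  qed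
  have "small (\<lambda>u. \<exists>v. M u v)"
  proof (rule small_subset)
    show "param_def U (\<lambda>e. \<exists>v. M (e 0) v)" by (intro param_intros param_sub2[OF pM])
    fix u assume "\<exists>v. M u v"
    then obtain d v where d: "d \<epsilon> r" "app U d u v" unfolding M_def by blast
    have "\<exists>a q. u \<epsilon> a \<and> a \<epsilon> q \<and> q \<epsilon> st (\<lambda>q. \<exists>d. q \<epsilon> d \<and> d \<epsilon> r)"
      using app_Union2[OF d(2)] d(1) unfolding mem_st[OF small_Union] by blast
    then show "u \<epsilon> st (\<lambda>u. \<exists>a q. u \<epsilon> a \<and> a \<epsilon> q \<and> q \<epsilon> st (\<lambda>q. \<exists>d. q \<epsilon> d \<and> d \<epsilon> r))"
      unfolding mem_st[OF small_Union2] .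
  qed
  then obtain b where b: "is_set U b" "\<And>u. u \<epsilon> b \<longleftrightarrow> (\<exists>v. M u v)" unfolding small_def by blast
  have "\<exists>u. u \<epsilon> b \<and> \<not> u \<epsilon> F" if F: "tfin F" for F
  proof (rule ccontr)
    assume bF: "\<not> (\<exists>u. u \<epsilon> b \<and> \<not> u \<epsilon> F)"
    \<comment> \<open>Tarski finiteness of \<open>F\<close> is tested on the family of domains of
      good members of the chain. If all of \<open>b\<close> lay in \<open>F\<close>, a domain with
      maximal trace would still be enlarged at the next link.\<close>
    define D where "D d x \<longleftrightarrow> good d \<and> is_set U x \<and> (\<forall>u. u \<epsilon> x \<longleftrightarrow> (\<exists>v. app U d u v))" for d x
    have pD: "param_def U (\<lambda>e. D (e 0) (e (Suc 0)))"
      unfolding D_def by (intro param_intros pgood param_app)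
    have "small (\<lambda>x. \<exists>d. d \<epsilon> r \<and> D d x)"
      by (rule small_image[OF pD]) (auto simp: D_def intro: ext)
    then obtain g where g: "\<And>x. x \<epsilon> g \<longleftrightarrow> (\<exists>d. d \<epsilon> r \<and> D d x)" unfolding small_def by blast
    have exD: "\<exists>x. D d x" if "good d" for d
    proof -
      have "small (\<lambda>u. \<exists>v. app U d u v)"
        by (rule small_subset[of _ "st (\<lambda>u. \<exists>a q. u \<epsilon> a \<and> a \<epsilon> q \<and> q \<epsilon> d)"],
          intro param_intros param_app, unfold mem_st[OF small_Union2], use app_Union2 in blast)
      then show ?thesis using that unfolding D_def small_def by blast
    qed
    have "good emp" unfolding good_def matching_def app_iff by simp
    then have ne: "\<exists>x. x \<epsilon> g" using g r(1) exD by blast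
    obtain x where x: "x \<epsilon> g"
      "\<And>y. y \<epsilon> g \<Longrightarrow> \<forall>u. u \<epsilon> x \<longrightarrow> u \<epsilon> F \<longrightarrow> u \<epsilon> y \<Longrightarrow> \<forall>u. u \<epsilon> y \<longrightarrow> u \<epsilon> F \<longrightarrow> u \<epsilon> x"
      using F[unfolded tfin_def, THEN spec, THEN mp, OF ne] by blast
    obtain d where d: "d \<epsilon> r" "D d x" using x(1) g by blast
    obtain d' where d': "d' \<epsilon> r" "R d d'" using r(2) d(1) by blast
    have gd: "good d'" "S d d'" using d d' unfolding D_def R_def by blast+
    obtain u v where uv: "app U d' u v" "\<not> app U d u v" using d d' unfolding D_def R_def by blast
    obtain y where y: "D d' y" using exD gd by blast
    then have "y \<epsilon> g" using g d' by blast
    moreover have "\<forall>u. u \<epsilon> x \<longrightarrow> u \<epsilon> F \<longrightarrow> u \<epsilon> y"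
      using d y gd unfolding D_def S_def app_iff by blast
    moreover have "u \<epsilon> y" using y uv unfolding D_def by blast
    moreover have "u \<epsilon> F" using bF b(2) uv gd d' unfolding M_def by blast
    ultimately have "u \<epsilon> x" using x(2) by blast
    \<comment> \<open>The pair added in \<open>d'\<close> has a new first component: an older pair
      at \<open>u\<close> would survive in \<open>d'\<close> and coincide with it.\<close>
    then obtain v' where v': "app U d u v'" using d unfolding D_def by blast
    then have "app U d' u v'" using gd unfolding S_def app_iff by blast
    then have "v' = v" using matching_inj[OF gd(1)[unfolded good_def] uv(1)] by blast
    then show False using v' uv by blast
  qed
  then show thesis using that[OF pM mM b(2,1)] by blast
qed

section \<open>Swapping a matching, and transpositions\<close>

lemma matching_aut:
  assumes M: "param_def U (\<lambda>e. M (e 0) (e (Suc 0)))" "matching K M"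
  obtains j where "is_aut j" "\<And>u v. M u v \<Longrightarrow> j u = v"
    "\<And>x. (\<And>u. in_tc x u \<Longrightarrow> urel U u \<Longrightarrow> K u) \<Longrightarrow> j x = x"
proof -
  define S where "S u v \<longleftrightarrow> M u v \<or> M v u \<or> u = v \<and> \<not> (\<exists>w. M u w \<or> M w u)" for u v
  have ex1: "\<exists>!v. S u v" for u
  proof (cases "\<exists>w. M u w \<or> M w u")
    case True
    then obtain w where w: "M u w \<or> M w u" by blast
    have "S u v \<longleftrightarrow> v = w" for v using w matching_inj[OF M(2)] unfolding S_def by blast
    then show ?thesis by simp
  next
    case False
    then show ?thesis unfolding S_def by blast
  qed
  define \<sigma> where "\<sigma> u = (THE v. S u v)" for u
  have "S u (\<sigma> u)" for u unfolding \<sigma>_def by (rule theI'[OF ex1])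
  then have \<sigma>: "\<sigma> u = v \<longleftrightarrow> S u v" for u v using ex1 by blast
  have "param_def U (\<lambda>e. \<sigma> (e 0) = e (Suc 0))"
    unfolding \<sigma> S_def by (intro param_intros param_sub2[OF M(1)])
  moreover have "\<sigma> (\<sigma> u) = u" for u
  proof -
    have "S u v \<Longrightarrow> S v u" for v unfolding S_def by blast
    then show ?thesis using \<sigma> by blast
  qed
  moreover have "urel U (\<sigma> u)" if "urel U u" for u
  proof -
    have "S u v \<Longrightarrow> urel U v" for v using that matchingD[OF M(2)] unfolding S_def by blast
    then show ?thesis using \<sigma> by blast
  qed
  ultimately obtain j where j: "is_aut j" "\<And>u. urel U u \<Longrightarrow> j u = \<sigma> u"
    "\<And>x. (\<And>u. in_tc x u \<Longrightarrow> urel U u \<Longrightarrow> \<sigma> u = u) \<Longrightarrow> j x = x"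
    using ex_aut[of \<sigma>] by blast
  have "j u = v" if "M u v" for u v
    using j(2)[of u] matchingD[OF M(2) that] \<sigma>[of u v] that unfolding S_def by simp
  moreover have "\<sigma> u = u" if "K u" for u
    using \<sigma>[of u u] matchingD[OF M(2)] that unfolding S_def by blast
  ultimately show thesis using that j(1,3) by blast
qed

lemma transposition_aut:
  assumes "urel U c" "urel U c'"
  obtains j where "is_aut j" "j c = c'" "\<And>u. urel U u \<Longrightarrow> u \<noteq> c \<Longrightarrow> u \<noteq> c' \<Longrightarrow> j u = u"
    "\<And>x. \<not> in_tc x c \<Longrightarrow> \<not> in_tc x c' \<Longrightarrow> j x = x"
proof -
  define \<tau> where "\<tau> u = (if u = c then c' else if u = c' then c else u)" for u
  have \<tau>: "\<tau> u = v \<longleftrightarrow> u = c \<and> v = c' \<or> u = c' \<and> v = c \<or> u \<noteq> c \<and> u \<noteq> c' \<and> v = u" for u v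
    unfolding \<tau>_def by auto
  have "param_def U (\<lambda>e. \<tau> (e 0) = e (Suc 0))" unfolding \<tau> by (intro param_intros)
  moreover have "\<tau> (\<tau> u) = u" "urel U u \<Longrightarrow> urel U (\<tau> u)" for u
    using assms unfolding \<tau>_def by auto
  ultimately obtain j where j: "is_aut j" "\<And>u. urel U u \<Longrightarrow> j u = \<tau> u"
    "\<And>x. (\<And>u. in_tc x u \<Longrightarrow> urel U u \<Longrightarrow> \<tau> u = u) \<Longrightarrow> j x = x"
    using ex_aut[of \<tau>] by blast
  show thesis
  proof (rule that[OF j(1)])
    show "j c = c'" using j(2) assms unfolding \<tau>_def by simp
    show "j u = u" if "urel U u" "u \<noteq> c" "u \<noteq> c'" for u using j(2) that unfolding \<tau>_def by simp
    show "j x = x" if "\<not> in_tc x c" "\<not> in_tc x c'" for x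
      using that by (intro j(3)) (auto simp: \<tau>_def)
  qed
qed

section \<open>The support argument\<close>

lemma urelements_form_set_if_law_V:
  assumes f: "param_definable_map U f" "basic_law_V U f"
  shows "urelements_form_set U"
proof (rule ccontr)
  assume A: "\<not> urelements_form_set U"
  obtain \<phi> P where P: "P \<in> classes U"
    and \<phi>: "\<And>X y. X \<in> classes U \<Longrightarrow> f X = y \<longleftrightarrow> sat2 U (\<lambda>_. y) (X \<cdot> (\<lambda>_. P)) \<phi>"
    using f(1) unfolding param_definable_map_def by blast
  obtain \<psi> p where Pp: "P = {x. sat U (x \<cdot> (\<lambda>_. p)) \<psi>}" using P unfolding classes_def by blast
  \<comment> \<open>Fixing \<open>p\<close> fixes the class parameter \<open>P\<close>, so the
    formula that defines \<open>f\<close> is invariant under \<open>j\<close>.\<close>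
  have equivariant: "f (j ` X) = j (f X)" if j: "is_aut j" "j p = p" and X: "X \<in> classes U" for j X
  proof -
    have "j ` P = P" using aut_definable_class[OF j(1), of p \<psi>] j(2) unfolding Pp by simp
    then have "(j ` X \<cdot> (\<lambda>_. P)) = (\<lambda>k. j ` (X \<cdot> (\<lambda>_. P)) k)"
      using scons_map[of "image j" X "\<lambda>_. P"] by simp
    then have "sat2 U (\<lambda>_. j (f X)) (j ` X \<cdot> (\<lambda>_. P)) \<phi> \<longleftrightarrow> sat2 U (\<lambda>_. f X) (X \<cdot> (\<lambda>_. P)) \<phi>"
      using sat2_aut[OF j(1), of "\<lambda>_. f X" "X \<cdot> (\<lambda>_. P)" \<phi>] by simp
    then show ?thesis using \<phi>[OF classes_aut[OF j(1) X]] \<phi>[OF X] by blast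
  qed
  obtain M b where M: "param_def U (\<lambda>e. M (e 0) (e (Suc 0)))" "matching (in_tc p) M"
    and b: "\<And>u. u \<epsilon> b \<longleftrightarrow> (\<exists>v. M u v)" "is_set U b" "\<And>F. tfin F \<Longrightarrow> \<exists>u. u \<epsilon> b \<and> \<not> u \<epsilon> F"
    using ex_matching[OF A small_tc[of p] param_in_tc[OF tm_const tm_var]] by blast
  have bu: "urel U u" if "u \<epsilon> b" for u using that b(1) matchingD[OF M(2)] by blast
  define y where "y = f (near b)"
  have supp: "in_tc p a" if a: "in_tc y a" "urel U a" for a
  proof (rule ccontr)
    assume np: "\<not> in_tc p a"
    \<comment> \<open>Exchanging \<open>a\<close> with a fresh \<open>a'\<close> fixes
      \<open>p\<close> and the class, hence \<open>y\<close>; but it carries \<open>a\<close> to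
      \<open>a'\<close> and so puts \<open>a'\<close> below \<open>y\<close>.\<close>
    obtain a' where a': "urel U a'" "\<not> (in_tc p a' \<or> in_tc y a')"
      by (rule fresh_urelement[OF A small_un[OF small_tc small_tc]])
    obtain j where j: "is_aut j" "j a = a'" "\<And>u. urel U u \<Longrightarrow> u \<noteq> a \<Longrightarrow> u \<noteq> a' \<Longrightarrow> j u = u"
      "\<And>x. \<not> in_tc x a \<Longrightarrow> \<not> in_tc x a' \<Longrightarrow> j x = x"
      using transposition_aut[OF a(2) a'(1)] by blast
    have "j y = y"
      using equivariant[OF j(1) j(4) near_class[of b]] near_aut[OF j(1,3) bu] np a' unfolding y_def by simp
    then show False using in_tc_aut[OF j(1) a(1)] j(2) a' by simp
  qed
  obtain j where j: "is_aut j" "\<And>u v. M u v \<Longrightarrow> j u = v"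
    "\<And>x. (\<And>u. in_tc x u \<Longrightarrow> urel U u \<Longrightarrow> in_tc p u) \<Longrightarrow> j x = x"
    using matching_aut[OF M] by blast
  \<comment> \<open>By \<open>supp\<close> the urelements below \<open>y\<close> lie below
    \<open>p\<close>, a region that the matching avoids.\<close>
  have "j p = p" "j y = y" using j(3) supp by blast+
  then have "f (j ` near b) = f (near b)" using equivariant[OF j(1) _ near_class] y_def by simp
  then have jb: "j ` near b = near b"
    using f(2) near_class classes_aut[OF j(1) near_class] unfolding basic_law_V_def by blast
  have "b \<in> near b" unfolding near_def using b(2) bu tfin_emp by blast
  then have "j b \<in> near b" using jb by blast
  then obtain F where F: "tfin F" "\<And>u. \<not> u \<epsilon> F \<Longrightarrow> u \<epsilon> j b \<longleftrightarrow> u \<epsilon> b" unfolding near_def by blast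
  obtain u where u: "u \<epsilon> b" "\<not> u \<epsilon> F" using b(3)[OF F(1)] by blast
  then obtain v where v: "M u v" using b(1) by blast
  \<comment> \<open>Membership of \<open>u\<close> in \<open>j b\<close> amounts to membership of
    its partner \<open>v\<close> in \<open>b\<close>, which would make \<open>v\<close> a first
    component as well.\<close>
  have "v \<epsilon> b" using F(2)[OF u(2)] u(1) j(2)[OF v] mem_aut[OF j(1)] by simp
  then obtain w where "M v w" using b(1) by blast
  then show False using matching_inj[OF M(2) v] matchingD[OF M(2) v] by blast
qed

end

subsection \<open>Second-order definability\<close>

primrec emb :: "fo \<Rightarrow> so" where
  "emb (FMem i j) = SMem i j"
| "emb (FEq i j) = SEq i j"
| "emb (FUr i) = SUr i"
| "emb (FNeg \<phi>) = SNeg (emb \<phi>)"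
| "emb (FAnd \<phi> \<psi>) = SAnd (emb \<phi>) (emb \<psi>)"
| "emb (FAll \<phi>) = SAllObj (emb \<phi>)"

lemma sat2_emb: "sat2 U e C (emb \<phi>) \<longleftrightarrow> sat U e \<phi>"
  by (induction \<phi> arbitrary: e) simp_all

primrec sren :: "(nat \<Rightarrow> nat) \<Rightarrow> (nat \<Rightarrow> nat) \<Rightarrow> so \<Rightarrow> so" where
  "sren r s (SMem i j) = SMem (r i) (r j)"
| "sren r s (SEq i j) = SEq (r i) (r j)"
| "sren r s (SUr i) = SUr (r i)"
| "sren r s (SIn i k) = SIn (r i) (s k)"
| "sren r s (SNeg \<phi>) = SNeg (sren r s \<phi>)"
| "sren r s (SAnd \<phi> \<psi>) = SAnd (sren r s \<phi>) (sren r s \<psi>)"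
| "sren r s (SAllObj \<phi>) = SAllObj (sren (0 \<cdot> (\<lambda>i. Suc (r i))) s \<phi>)"
| "sren r s (SAllCls \<phi>) = SAllCls (sren r (0 \<cdot> (\<lambda>i. Suc (s i))) \<phi>)"

lemma sat2_sren: "sat2 U e C (sren r s \<phi>) \<longleftrightarrow> sat2 U (\<lambda>i. e (r i)) (\<lambda>k. C (s k)) \<phi>"
  by (induction \<phi> arbitrary: e C r s) (simp_all add: scons_comp cong del: nat.case_cong_weak)

lemma ofv_sren: "ofv (sren r s \<phi>) \<subseteq> range r"
proof (induction \<phi> arbitrary: r s)
  case (SAllObj \<phi>)
  have "n \<in> range r" if "Suc n \<in> ofv (sren (0 \<cdot> (\<lambda>i. Suc (r i))) s \<phi>)" for n
    using SAllObj[of "0 \<cdot> (\<lambda>i. Suc (r i))" s] that by (fastforce split: nat.splits)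
  then show ?case by auto
qed auto

lemma cfv_sren: "cfv (sren r s \<phi>) \<subseteq> range s"
proof (induction \<phi> arbitrary: r s)
  case (SAllCls \<phi>)
  have "n \<in> range s" if "Suc n \<in> cfv (sren r (0 \<cdot> (\<lambda>i. Suc (s i))) \<phi>)" for n
    using SAllCls[of r "0 \<cdot> (\<lambda>i. Suc (s i))"] that by (fastforce split: nat.splits)
  then show ?case by auto
qed auto

definition so_def :: "'a ustruct \<Rightarrow> ((nat \<Rightarrow> 'a) \<Rightarrow> (nat \<Rightarrow> 'a set) \<Rightarrow> bool) \<Rightarrow> bool" where
  "so_def U P \<longleftrightarrow> (\<exists>\<phi>. \<forall>e C. sat2 U e C \<phi> \<longleftrightarrow> P e C)"

lemma so_pure: "pure_def U P \<Longrightarrow> so_def U (\<lambda>e C. P e)"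
  unfolding pure_def_def so_def_def by (metis sat2_emb)

lemma so_in: "so_def U (\<lambda>e C. e i \<in> C k)"
  unfolding so_def_def by (rule exI[of _ "SIn i k"]) simp

lemma so_neg: "so_def U P \<Longrightarrow> so_def U (\<lambda>e C. \<not> P e C)"
  unfolding so_def_def by (metis sat2.simps(5))

lemma so_and: "so_def U P \<Longrightarrow> so_def U Q \<Longrightarrow> so_def U (\<lambda>e C. P e C \<and> Q e C)"
  unfolding so_def_def by (metis sat2.simps(6))

lemma so_all:
  assumes "so_def U (\<lambda>e C. Q (\<lambda>i. e (Suc i)) C (e 0))"
  shows "so_def U (\<lambda>e C. \<forall>x. Q e C x)"
proof -
  obtain \<phi> where "\<And>e C. sat2 U e C \<phi> \<longleftrightarrow> Q (\<lambda>i. e (Suc i)) C (e 0)"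
    using assms unfolding so_def_def by blast
  then have "\<forall>e C. sat2 U e C (SAllObj \<phi>) \<longleftrightarrow> (\<forall>x. Q e C x)" by simp
  then show ?thesis unfolding so_def_def by blast
qed

lemma so_all_class:
  assumes "so_def U (\<lambda>e C. Q e (\<lambda>i. C (Suc i)) (C 0))"
  shows "so_def U (\<lambda>e C. \<forall>X\<in>classes U. Q e C X)"
proof -
  obtain \<phi> where "\<And>e C. sat2 U e C \<phi> \<longleftrightarrow> Q e (\<lambda>i. C (Suc i)) (C 0)"
    using assms unfolding so_def_def by blast
  then have "\<forall>e C. sat2 U e C (SAllCls \<phi>) \<longleftrightarrow> (\<forall>X\<in>classes U. Q e C X)" by simp
  then show ?thesis unfolding so_def_def by blast
qed

lemma so_or:
  assumes "so_def U P" "so_def U Q" shows "so_def U (\<lambda>e C. P e C \<or> Q e C)"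
proof -
  have "so_def U (\<lambda>e C. \<not> (\<not> P e C \<and> \<not> Q e C))" by (intro so_neg so_and assms)
  then show ?thesis by simp
qed

lemma so_imp:
  assumes "so_def U P" "so_def U Q" shows "so_def U (\<lambda>e C. P e C \<longrightarrow> Q e C)"
  unfolding imp_conv_disj by (intro so_neg so_or assms)

lemma so_iff:
  assumes "so_def U P" "so_def U Q" shows "so_def U (\<lambda>e C. P e C \<longleftrightarrow> Q e C)"
  unfolding iff_conv_conj_imp by (intro so_and so_imp assms)

lemma so_ex:
  assumes "so_def U (\<lambda>e C. Q (\<lambda>i. e (Suc i)) C (e 0))"
  shows "so_def U (\<lambda>e C. \<exists>x. Q e C x)"
proof -
  have "so_def U (\<lambda>e C. \<not> (\<forall>x. \<not> Q e C x))" by (intro so_neg so_all assms)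
  then show ?thesis by simp
qed

lemma so_ex_class:
  assumes "so_def U (\<lambda>e C. Q e (\<lambda>i. C (Suc i)) (C 0))"
  shows "so_def U (\<lambda>e C. \<exists>X\<in>classes U. Q e C X)"
proof -
  have "so_def U (\<lambda>e C. \<not> (\<forall>X\<in>classes U. \<not> Q e C X))" by (intro so_neg so_all_class assms)
  then show ?thesis by simp
qed

lemma definable_mapI:
  assumes "so_def U (\<lambda>e C. P (C 0) (e 0))"
    and "\<And>X y. X \<in> classes U \<Longrightarrow> f X = y \<longleftrightarrow> P X y"
  shows "definable_map U f"
proof -
  obtain \<phi> where \<phi>: "\<And>e C. sat2 U e C \<phi> \<longleftrightarrow> P (C 0) (e 0)"
    using assms(1) unfolding so_def_def by blast
  define \<phi>' where "\<phi>' = sren (\<lambda>_. 0) (\<lambda>_. 0) \<phi>"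
  have "ofv \<phi>' \<subseteq> {0}" "cfv \<phi>' \<subseteq> {0}"
    using ofv_sren[of "\<lambda>_. 0"] cfv_sren[of _ "\<lambda>_. 0"] unfolding \<phi>'_def by fastforce+
  moreover have "f X = y \<longleftrightarrow> sat2 U (\<lambda>_. y) (\<lambda>_. X) \<phi>'" if "X \<in> classes U" for X y
    using assms(2)[OF that] unfolding \<phi>'_def sat2_sren \<phi> .
  ultimately show ?thesis unfolding definable_map_def by blast
qed

lemma definable_map_imp_param:
  assumes "definable_map U f" "P \<in> classes U" shows "param_definable_map U f"
proof -
  obtain \<phi> where \<phi>: "\<And>X y. X \<in> classes U \<Longrightarrow> f X = y \<longleftrightarrow> sat2 U (\<lambda>_. y) (\<lambda>_. X) \<phi>"
    using assms(1) unfolding definable_map_def by blast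
  define \<phi>' where "\<phi>' = sren (\<lambda>_. 0) (\<lambda>_. 0) \<phi>"
  have "ofv \<phi>' \<subseteq> {0}" "cfv \<phi>' \<subseteq> {0, 1}"
    using ofv_sren[of "\<lambda>_. 0"] cfv_sren[of _ "\<lambda>_. 0"] unfolding \<phi>'_def by fastforce+
  moreover have "f X = y \<longleftrightarrow> sat2 U (\<lambda>_. y) (X \<cdot> (\<lambda>_. P)) \<phi>'" if "X \<in> classes U" for X y
    using \<phi>[OF that] unfolding \<phi>'_def sat2_sren by simp
  ultimately show ?thesis using assms(2) unfolding param_definable_map_def by blast
qed

context zfu
begin

subsection \<open>The hierarchy of definable classes\<close>

primrec num :: "nat \<Rightarrow> 'a" where
  "num 0 = emp"
| "num (Suc i) = sc (num i)"

lemma num_eq_emp: "num i = emp \<longleftrightarrow> i = 0"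
  by (cases i) (auto simp: sc_neq_emp)

lemma num_eq [simp]: "num i = num k \<longleftrightarrow> i = k"
  by (induction i k rule: diff_induct) (auto simp: num_eq_emp sc_neq_emp[symmetric])

lemma N_num: "N (num i)"
  by (induction i) (auto intro: N_emp N_sc)

text \<open>Only standard integers lie below a standard one. Minimality outside \<open>U\<close>
  therefore agrees with minimality inside.\<close>

lemma mem_num: "m \<epsilon> num i \<longleftrightarrow> (\<exists>k<i. m = num k)"
  by (induction i) (auto simp: mem_sc less_Suc_eq)

text \<open>Each standard numeral gets its own parameter-free formula, as the tags must not
  introduce parameters into the definition of the map.\<close>

primrec is_num :: "nat \<Rightarrow> 'a \<Rightarrow> bool" where
  "is_num 0 w \<longleftrightarrow> is_empty U w"
| "is_num (Suc i) w \<longleftrightarrow> (\<exists>v. is_num i v \<and> is_succ U v w)"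

lemma is_num_iff: "is_num i w \<longleftrightarrow> w = num i"
  by (induction i arbitrary: w) (auto simp: is_empty_iff is_succ_iff)

lemma pure_num: "pure_def U (\<lambda>e. is_num i (e k))"
proof (induction i arbitrary: k)
  case 0
  then show ?case unfolding is_num.simps is_empty_def is_set_def by (intro pure_intros)
next
  case (Suc i)
  show ?case unfolding is_num.simps is_succ_def is_set_def by (intro pure_intros Suc)
qed

text \<open>
  Formulas are evaluated on stacks, i.e. assignments coded as nested pairs. The tags mean: copy,
  nand, universal quantification over the top entry, weakening, exchange of the two top entries,
  and the atomic formulas on the top entries. The other atomic formulas arise by weakening and
  exchange, and equality is defined from membership.
\<close>

definition step :: "('a \<Rightarrow> 'a \<Rightarrow> bool) \<Rightarrow> 'a \<Rightarrow> 'a \<Rightarrow> bool" where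
  "step T z x \<longleftrightarrow> (\<exists>w y u v. is_pair U z w y \<and> is_pair U y u v \<and>
     (is_num 0 w \<and> T u x \<or>
      is_num 1 w \<and> \<not> (T u x \<and> T v x) \<or>
      is_num 2 w \<and> (\<forall>a t. is_pair U t a x \<longrightarrow> T u t) \<or>
      is_num 3 w \<and> (\<exists>a t. is_pair U x a t \<and> T u t) \<or>
      is_num 4 w \<and> (\<exists>a b s t s' t'. is_pair U x a s \<and> is_pair U s b t \<and>
        is_pair U s' a t \<and> is_pair U t' b s' \<and> T u t') \<or>
      is_num 5 w \<and> (\<exists>a b s t. is_pair U x a s \<and> is_pair U s b t \<and> a \<epsilon> b) \<or>
      is_num 6 w \<and> (\<exists>a t. is_pair U x a t \<and> urel U a)))"

lemma step_simps:
  "step T (pr (num 0) (pr u v)) x \<longleftrightarrow> T u x"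
  "step T (pr (num 1) (pr u v)) x \<longleftrightarrow> \<not> (T u x \<and> T v x)"
  "step T (pr (num 2) (pr u v)) x \<longleftrightarrow> (\<forall>a. T u (pr a x))"
  "step T (pr (num 3) (pr u v)) (pr a x) \<longleftrightarrow> T u x"
  "step T (pr (num 4) (pr u v)) (pr a (pr b x)) \<longleftrightarrow> T u (pr b (pr a x))"
  "step T (pr (num 5) (pr u v)) (pr a (pr b x)) \<longleftrightarrow> a \<epsilon> b"
  "step T (pr (num 6) (pr u v)) (pr a x) \<longleftrightarrow> urel U a"
  unfolding step_def is_pair_iff is_num_iff by (auto simp del: num.simps)

lemma param_num: "tm s \<Longrightarrow> param_def U (\<lambda>e. is_num i (s e))"
  unfolding is_num_iff by (intro param_intros)

lemma param_step:
  assumes "\<And>s t. tm s \<Longrightarrow> tm t \<Longrightarrow> param_def U (\<lambda>e. T (s e) (t e))" "tm s" "tm t"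
  shows "param_def U (\<lambda>e. step T (s e) (t e))"
  by (rule param_sub2[OF _ assms(2,3)])
    (unfold step_def, intro param_intros param_num assms(1))

text \<open>The recursion runs on numbers outside \<open>U\<close>: the formula grows with
  \<open>i\<close>.\<close>

primrec stage :: "nat \<Rightarrow> 'a \<Rightarrow> 'a \<Rightarrow> bool" where
  "stage 0 = (\<lambda>z x. False)"
| "stage (Suc i) = step (stage i)"

lemma param_stage: "tm s \<Longrightarrow> tm t \<Longrightarrow> param_def U (\<lambda>e. stage i (s e) (t e))"
proof (induction i arbitrary: s t)
  case 0
  show ?case unfolding stage.simps by (rule param_bool)
next
  case (Suc i)
  show ?case unfolding stage.simps by (rule param_step[OF Suc.IH Suc.prems])
qed

section \<open>Coding formulas by stacks\<close>

primrec stack :: "nat \<Rightarrow> (nat \<Rightarrow> 'a) \<Rightarrow> 'a \<Rightarrow> 'a" where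
  "stack 0 e r = r"
| "stack (Suc k) e r = pr (e 0) (stack k (\<lambda>i. e (Suc i)) r)"

lemma stack_add: "stack (k + l) e r = stack k e (stack l (\<lambda>i. e (k + i)) r)"
  by (induction k arbitrary: e) simp_all

text \<open>Correctness for every tail \<open>r\<close> makes the entries below depth
  \<open>k\<close> irrelevant, so that codes of different depths can be combined.\<close>

definition coded :: "nat \<Rightarrow> nat \<Rightarrow> ((nat \<Rightarrow> 'a) \<Rightarrow> bool) \<Rightarrow> bool" where
  "coded i k P \<longleftrightarrow> (\<exists>u. \<forall>e r. stage i u (stack k e r) \<longleftrightarrow> P e)"

lemma codedI: "(\<And>e r. stage i u (stack k e r) \<longleftrightarrow> P e) \<Longrightarrow> coded i k P"
  unfolding coded_def by blast

text \<open>The copy tag carries a code to the next stage; greater depth is obtained by absorbing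
  entries into the tail.\<close>

lemma coded_mono:
  assumes "coded i k P" "i \<le> i'" "k \<le> k'" shows "coded i' k' P"
proof -
  have "coded (i + d) k P" for d
  proof (induction d)
    case (Suc d)
    then obtain u where "\<And>e r. stage (i + d) u (stack k e r) \<longleftrightarrow> P e" unfolding coded_def by blast
    then show ?case by (intro codedI[of _ "pr (num 0) (pr u u)"]) (simp add: step_simps del: num.simps)
  qed (simp add: assms)
  then have "coded i' k P" using assms(2) le_Suc_ex by blast
  then show ?thesis using assms(3) stack_add unfolding coded_def by (metis le_Suc_ex)
qed

definition codable :: "((nat \<Rightarrow> 'a) \<Rightarrow> bool) \<Rightarrow> bool" where
  "codable P \<longleftrightarrow> (\<exists>i k. coded i k P)"

lemma codableI: "(\<And>e r. stage i u (stack k e r) \<longleftrightarrow> P e) \<Longrightarrow> codable P"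
  unfolding codable_def coded_def by blast

lemma codableE:
  assumes "codable P" obtains i k where "coded i (Suc (Suc k)) P"
  using assms coded_mono[OF _ le_refl le_add2, of _ _ P "Suc (Suc 0)"] unfolding codable_def by auto

lemma codable_nand:
  assumes "codable P" "codable Q" shows "codable (\<lambda>e. \<not> (P e \<and> Q e))"
proof -
  obtain i k i' k' where ik: "coded i k P" "coded i' k' Q" using assms unfolding codable_def by blast
  have "coded (max i i') (max k k') P" "coded (max i i') (max k k') Q"
    by (rule coded_mono[OF ik(1)], simp_all) (rule coded_mono[OF ik(2)], simp_all)
  then obtain u v where "\<And>e r. stage (max i i') u (stack (max k k') e r) \<longleftrightarrow> P e"
    "\<And>e r. stage (max i i') v (stack (max k k') e r) \<longleftrightarrow> Q e" unfolding coded_def by blast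
  then have "coded (Suc (max i i')) (max k k') (\<lambda>e. \<not> (P e \<and> Q e))"
    by (intro codedI[of _ "pr (num 1) (pr u v)"]) (simp add: step_simps del: num.simps One_nat_def)
  then show ?thesis unfolding codable_def by blast
qed

lemma codable_neg: "codable P \<Longrightarrow> codable (\<lambda>e. \<not> P e)"
  using codable_nand[of P P] by simp

lemma codable_and: assumes "codable P" "codable Q" shows "codable (\<lambda>e. P e \<and> Q e)"
  using codable_neg[OF codable_nand[OF assms]] by simp

lemma codable_all: assumes "codable P" shows "codable (\<lambda>e. \<forall>a. P (a \<cdot> e))"
proof -
  obtain i k where "coded i (Suc (Suc k)) P" using assms by (rule codableE)
  then obtain u where u: "\<And>e r. stage i u (stack (Suc (Suc k)) e r) \<longleftrightarrow> P e" unfolding coded_def by blast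
  have "stage (Suc i) (pr (num 2) (pr u u)) (stack (Suc k) e r) \<longleftrightarrow> (\<forall>a. P (a \<cdot> e))" for e r
    using u[of "_ \<cdot> e" r] by (simp add: step_simps del: num.simps)
  then show ?thesis by (rule codableI)
qed

lemma codable_shift: assumes "codable P" shows "codable (\<lambda>e. P (\<lambda>i. e (Suc i)))"
proof -
  obtain i k u where u: "\<And>e r. stage i u (stack k e r) \<longleftrightarrow> P e"
    using assms unfolding codable_def coded_def by blast
  have "stage (Suc i) (pr (num 3) (pr u u)) (stack (Suc k) e r) \<longleftrightarrow> P (\<lambda>i. e (Suc i))" for e r
    using u by (simp add: step_simps del: num.simps)
  then show ?thesis by (rule codableI)
qed

lemma codable_swap:
  assumes "codable P" shows "codable (\<lambda>e. P (e (Suc 0) \<cdot> e 0 \<cdot> (\<lambda>i. e (Suc (Suc i)))))"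
proof -
  obtain i k where "coded i (Suc (Suc k)) P" using assms by (rule codableE)
  then obtain u where u: "\<And>e r. stage i u (stack (Suc (Suc k)) e r) \<longleftrightarrow> P e" unfolding coded_def by blast
  have "stage (Suc i) (pr (num 4) (pr u u)) (stack (Suc (Suc k)) e r) \<longleftrightarrow>
    P (e (Suc 0) \<cdot> e 0 \<cdot> (\<lambda>i. e (Suc (Suc i))))" for e r
    using u[of "e (Suc 0) \<cdot> e 0 \<cdot> (\<lambda>i. e (Suc (Suc i)))" r] by (simp add: step_simps del: num.simps)
  then show ?thesis by (rule codableI)
qed

lemma codable_mem01: "codable (\<lambda>e. e 0 \<epsilon> e (Suc 0))"
proof -
  have "stage (Suc 0) (pr (num 5) (pr emp emp)) (stack (Suc (Suc 0)) e r) \<longleftrightarrow> e 0 \<epsilon> e (Suc 0)" for e r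
    by (simp add: step_simps del: num.simps)
  then show ?thesis by (rule codableI)
qed

lemma codable_ur: "codable (\<lambda>e. urel U (e i))"
proof (induction i)
  case 0
  have "stage (Suc 0) (pr (num 6) (pr emp emp)) (stack (Suc 0) e r) \<longleftrightarrow> urel U (e 0)" for e r
    by (simp add: step_simps del: num.simps)
  then show ?case by (rule codableI)
next
  case (Suc i)
  then show ?case using codable_shift by fast
qed

text \<open>Weakening raises both indices, and exchange then returns the index 1 to 0.\<close>

lemma codable_mem_0_Suc: "codable (\<lambda>e. e 0 \<epsilon> e (Suc i))" and codable_mem_Suc_0: "codable (\<lambda>e. e (Suc i) \<epsilon> e 0)"
proof (induction i)
  case 0
  show "codable (\<lambda>e. e 0 \<epsilon> e (Suc 0))" by (rule codable_mem01)
  show "codable (\<lambda>e. e (Suc 0) \<epsilon> e 0)" using codable_swap[OF codable_mem01] by simp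
next
  case (Suc i)
  show "codable (\<lambda>e. e 0 \<epsilon> e (Suc (Suc i)))" using codable_swap[OF codable_shift[OF Suc(1)]] by simp
  show "codable (\<lambda>e. e (Suc (Suc i)) \<epsilon> e 0)" using codable_swap[OF codable_shift[OF Suc(2)]] by simp
qed

lemma codable_mem: "codable (\<lambda>e. e i \<epsilon> e j)"
proof (induction i j rule: diff_induct)
  case (1 i)
  show ?case
  proof (cases i)
    case 0
    \<comment> \<open>The atom comparing a variable with itself has no tag; by Foundation it is
      equivalent to a contradiction.\<close>
    have "codable (\<lambda>e. False)" using codable_and[OF codable_neg[OF codable_mem01] codable_mem01] by simp
    then show ?thesis using 0 not_mem_self by simp
  next
    case (Suc i)
    then show ?thesis using codable_mem_Suc_0 by simp
  qed
next
  case (2 j)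
  show ?case by (rule codable_mem_0_Suc)
next
  case (3 i j)
  then show ?case using codable_shift by fast
qed

lemma codable_sat: "codable (\<lambda>e. sat U e \<phi>)"
proof (induction \<phi>)
  case (FMem i j)
  show ?case unfolding sat.simps by (rule codable_mem)
next
  case (FEq i j)
  \<comment> \<open>One inclusion suffices: take for \<open>a\<close> the singleton of
    \<open>e i\<close>.\<close>
  have "(\<forall>a. \<not> (e i \<epsilon> a \<and> \<not> e j \<epsilon> a)) \<longleftrightarrow> e i = e j" for e :: "nat \<Rightarrow> 'a"
    using mem_up by metis
  moreover have "codable (\<lambda>e. \<forall>a. \<not> ((a \<cdot> e) (Suc i) \<epsilon> (a \<cdot> e) 0 \<and> \<not> (a \<cdot> e) (Suc j) \<epsilon> (a \<cdot> e) 0))"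
    by (intro codable_all codable_neg codable_and codable_mem)
  ultimately show ?case by simp
next
  case (FUr i)
  show ?case unfolding sat.simps by (rule codable_ur)
next
  case (FNeg \<phi>)
  then show ?case unfolding sat.simps by (rule codable_neg)
next
  case (FAnd \<phi> \<psi>)
  then show ?case unfolding sat.simps by (rule codable_and)
next
  case (FAll \<phi>)
  then show ?case unfolding sat.simps by (rule codable_all)
qed

lemma class_stage:
  assumes "X \<in> classes U" shows "\<exists>i u s. \<forall>x. x \<in> X \<longleftrightarrow> stage i u (pr x s)"
proof -
  obtain \<psi> z where X: "X = {x. sat U (x \<cdot> (\<lambda>_. z)) \<psi>}" using assms unfolding classes_def by blast
  obtain i k where "coded i (Suc (Suc k)) (\<lambda>e. sat U e \<psi>)" using codable_sat by (rule codableE)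
  then obtain u where u: "\<And>e r. stage i u (stack (Suc (Suc k)) e r) \<longleftrightarrow> sat U e \<psi>"
    unfolding coded_def by blast
  \<comment> \<open>Everything below the top entry is filled with the parameter, which also serves
    as the arbitrary tail; this stack is the \<open>s\<close> of the code.\<close>
  have "x \<in> X \<longleftrightarrow> stage i u (pr x (stack (Suc k) (\<lambda>_. z) z))" for x
    using u[of "x \<cdot> (\<lambda>_. z)" z] unfolding X by simp
  then show ?thesis by blast
qed

definition row :: "'a set \<Rightarrow> 'a \<Rightarrow> 'a \<Rightarrow> 'a \<Rightarrow> bool" where
  "row T n z x \<longleftrightarrow> (\<exists>y q. is_pair U y z x \<and> is_pair U q n y \<and> q \<in> T)"

lemma row_iff: "row T n z x \<longleftrightarrow> pr n (pr z x) \<in> T"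
  unfolding row_def is_pair_iff by blast

lemma param_row:
  assumes "T \<in> classes U" "tm r" "tm s" "tm t" shows "param_def U (\<lambda>e. row T (r e) (s e) (t e))"
  by (rule param_sub3[OF _ assms(2-4)]) (unfold row_def, intro param_intros param_class assms(1))

text \<open>A table of the stages from 0 to \<open>n\<close>, where \<open>n\<close> may be
  nonstandard. Later rows are left free, so two tables agree only up to row
  \<open>n\<close>.\<close>

definition history :: "'a set \<Rightarrow> 'a \<Rightarrow> bool" where
  "history T n \<longleftrightarrow> (\<forall>k z x. is_empty U k \<longrightarrow> \<not> row T k z x) \<and>
     (\<forall>k k'. k \<epsilon> n \<longrightarrow> is_succ U k k' \<longrightarrow> (\<forall>z x. row T k' z x \<longleftrightarrow> step (row T k) z x))"

lemma history_unique:
  assumes T: "T \<in> classes U" "history T n" and T': "T' \<in> classes U" "history T' n" and n: "N n"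
  shows "row T n = row T' n"
proof -
  have "(m \<epsilon> n \<or> m = n) \<longrightarrow> (\<forall>z x. row T m z x \<longleftrightarrow> row T' m z x)" if "N m" for m
    using that
  proof (rule N_induct)
    show "param_def U (\<lambda>e. (e 0 \<epsilon> n \<or> e 0 = n) \<longrightarrow> (\<forall>z x. row T (e 0) z x \<longleftrightarrow> row T' (e 0) z x))"
      by (intro param_intros param_row T(1) T'(1))
    show "(emp \<epsilon> n \<or> emp = n) \<longrightarrow> (\<forall>z x. row T emp z x \<longleftrightarrow> row T' emp z x)"
      using T(2) T'(2) unfolding history_def is_empty_iff by simp
    fix m assume m: "(m \<epsilon> n \<or> m = n) \<longrightarrow> (\<forall>z x. row T m z x \<longleftrightarrow> row T' m z x)"
    show "(sc m \<epsilon> n \<or> sc m = n) \<longrightarrow> (\<forall>z x. row T (sc m) z x \<longleftrightarrow> row T' (sc m) z x)"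
    proof
      assume "sc m \<epsilon> n \<or> sc m = n"
      then have mn: "m \<epsilon> n" using N_trans[OF n, of m "sc m"] mem_sc by blast
      then have "row T m = row T' m" using m by blast
      then show "\<forall>z x. row T (sc m) z x \<longleftrightarrow> row T' (sc m) z x"
        using T(2) T'(2) mn unfolding history_def is_succ_iff by simp
    qed
  qed
  then show ?thesis using n by blast
qed

definition hist :: "nat \<Rightarrow> 'a set" where
  "hist i = {q. \<exists>k\<le>i. \<exists>z x. q = pr (num k) (pr z x) \<and> stage k z x}"

lemma row_hist: "row (hist i) (num k) z x \<longleftrightarrow> k \<le> i \<and> stage k z x"
  unfolding row_iff hist_def by auto

text \<open>For a standard bound the table is a finite disjunction of definable rows, hence a single
  class.\<close>

lemma hist_class: "hist i \<in> classes U"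
proof -
  have st: "param_def U (\<lambda>e. \<exists>z x. e 0 = pr (num k) (pr z x) \<and> stage k z x)" for k
  proof -
    have "param_def U (\<lambda>e. \<exists>z x. \<exists>y. is_pair U y z x \<and> is_pair U (e 0) (num k) y \<and> stage k z x)"
      by (intro param_intros param_stage)
    then show ?thesis unfolding is_pair_iff by simp
  qed
  have "param_def U (\<lambda>e. \<exists>k\<le>i. \<exists>z x. e 0 = pr (num k) (pr z x) \<and> stage k z x)"
  proof (induction i)
    case 0
    show ?case using st[of 0] by simp
  next
    case (Suc i)
    then show ?case using param_or[OF Suc st[of "Suc i"]]
      unfolding le_Suc_eq by (simp only: conj_disj_distribR ex_disj_distrib simp_thms)
  qed
  then show ?thesis unfolding classes_iff hist_def by simp
qed

lemma history_hist: "history (hist i) (num i)"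
  unfolding history_def is_empty_iff is_succ_iff
proof (intro conjI allI impI)
  fix k z x assume "k = emp"
  then show "\<not> row (hist i) k z x" using row_hist[of i 0 z x] by simp
next
  fix k k' z x assume k: "k \<epsilon> num i" "k' = sc k"
  then obtain l where l: "l < i" "k = num l" unfolding mem_num by blast
  have "row (hist i) k = stage l" using l by (simp add: fun_eq_iff row_hist)
  then show "row (hist i) k' z x \<longleftrightarrow> step (row (hist i) k) z x"
    using row_hist[of i "Suc l" z x] l k(2) by simp
qed

text \<open>A code pairs the index \<open>u\<close> of a formula with the stack \<open>s\<close> of
  its parameters; the argument is pushed on top.\<close>

definition codes :: "'a set \<Rightarrow> ('a \<Rightarrow> 'a \<Rightarrow> bool) \<Rightarrow> 'a \<Rightarrow> bool" where
  "codes X T z \<longleftrightarrow> (\<exists>u s. is_pair U z u s \<and> (\<forall>x. x \<in> X \<longleftrightarrow> (\<exists>t. is_pair U t x s \<and> T u t)))"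

lemma codes_iff: "codes X T z \<longleftrightarrow> (\<exists>u s. z = pr u s \<and> (\<forall>x. x \<in> X \<longleftrightarrow> T u (pr x s)))"
  unfolding codes_def is_pair_iff by simp

lemma codes_inj: "codes X T z \<Longrightarrow> codes Y T z \<Longrightarrow> X = Y"
  unfolding codes_iff by auto

lemma param_codes:
  assumes "X \<in> classes U" "\<And>s t. tm s \<Longrightarrow> tm t \<Longrightarrow> param_def U (\<lambda>e. T (s e) (t e))" "tm s"
  shows "param_def U (\<lambda>e. codes X T (s e))"
  by (rule param_sub1[OF _ assms(3)])
    (unfold codes_def, intro param_intros param_class assms(1,2))

subsection \<open>Ranks and Scott's trick\<close>

text \<open>
  \<open>rk_le x y\<close> compares the ranks of \<open>x\<close> and \<open>y\<close> without ordinals.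
\<close>

definition rk_le :: "'a \<Rightarrow> 'a \<Rightarrow> bool" where
  "rk_le = bis (\<lambda>_ _. True) False"

lemma param_rk_le: "tm s \<Longrightarrow> tm t \<Longrightarrow> param_def U (\<lambda>e. rk_le (s e) (t e))"
  unfolding rk_le_def by (intro param_bis param_bool)

definition has_code :: "'a set \<Rightarrow> 'a \<Rightarrow> bool" where
  "has_code X n \<longleftrightarrow> (\<exists>T\<in>classes U. history T n \<and> (\<exists>z. codes X (row T n) z))"

text \<open>
  The stage \<open>n\<close> has to be minimized before the rank: the codes of \<open>X\<close> at a fixed stage form a
  definable class, whereas separation is not available for codes at varying stages.
\<close>

definition abstraction :: "'a set \<Rightarrow> 'a \<Rightarrow> bool" where
  "abstraction X y \<longleftrightarrow> (\<exists>n Z. is_pair U y n Z \<and> N n \<and> has_code X n \<and>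
     (\<forall>m. m \<epsilon> n \<longrightarrow> \<not> has_code X m) \<and> is_set U Z \<and>
     (\<exists>T\<in>classes U. history T n \<and>
       (\<forall>z. z \<epsilon> Z \<longleftrightarrow> codes X (row T n) z \<and> (\<forall>z'. codes X (row T n) z' \<longrightarrow> rk_le z z'))))"

text \<open>Every first-order ingredient is shown definable without parameters, since the map has to
  be definable and not just parametrically definable.\<close>

lemma so_abstraction: "so_def U (\<lambda>e C. abstraction (C 0) (e 0))"
proof -
  have pure: "pure_def U (\<lambda>e. is_empty U (e i))" "pure_def U (\<lambda>e. is_succ U (e i) (e j))"
    "pure_def U (\<lambda>e. is_set U (e i))" for i j
    unfolding is_empty_def is_succ_def is_set_def by (intro pure_intros)+
  have pureN: "pure_def U (\<lambda>e. N (e i))" for i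
    unfolding N_def is_inductive_def by (intro pure_intros pure)
  have pure_rk: "pure_def U (\<lambda>e. rk_le (e i) (e j))" for i j
    unfolding rk_le_def bis_def sim_def app_def by (simp, intro pure_intros pure_pair)
  have so_row: "so_def U (\<lambda>e C. row (C l) (e i) (e j) (e k))" for i j k l
    unfolding row_def by (intro so_and so_ex so_in so_pure[OF pure_pair])
  have so_step: "so_def U (\<lambda>e C. step (row (C l) (e i)) (e j) (e k))" for i j k l
    unfolding step_def
    by (intro so_and so_ex so_all so_or so_neg so_imp so_row so_pure[OF pure_pair] so_pure[OF pure_num]
      so_pure[OF pure_mem] so_pure[OF pure_ur])
  have so_hist: "so_def U (\<lambda>e C. history (C l) (e i))" for i l
    unfolding history_def
    by (intro so_and so_ex so_all so_or so_neg so_imp so_iff so_row so_step so_pure[OF pure(1)]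
      so_pure[OF pure(2)] so_pure[OF pure_mem])
  have so_codes: "so_def U (\<lambda>e C. codes (C m) (row (C l) (e i)) (e j))" for i j l m
    unfolding codes_def by (intro so_and so_ex so_all so_iff so_row so_in so_pure[OF pure_pair])
  show ?thesis
    unfolding abstraction_def has_code_def
    by (intro so_and so_ex so_all so_ex_class so_or so_neg so_imp so_iff so_hist so_codes
      so_pure[OF pure_pair] so_pure[OF pureN] so_pure[OF pure_rk] so_pure[OF pure(3)] so_pure[OF pure_mem])
qed

end

context zfu_dc
begin

lemma rk_le: "rk_le x y \<longleftrightarrow> (\<forall>x'. x' \<epsilon> x \<longrightarrow> (\<exists>y'. y' \<epsilon> y \<and> rk_le x' y'))"
  using bis_unfold[where G = "\<lambda>_ _. True" and b = False and x = x and y = y, OF param_bool] unfolding rk_le_def by simp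

lemma rk_le_refl: "rk_le x x"
proof (rule eps_induct[where P = "\<lambda>x. rk_le x x"])
  show "param_def U (\<lambda>e. rk_le (e 0) (e 0))" by (intro param_rk_le tm_var)
  show "rk_le x x" if "\<And>y. y \<epsilon> x \<Longrightarrow> rk_le y y" for x using that rk_le[of x x] by blast
qed

lemma rk_le_trans: assumes "rk_le x y" "rk_le y z" shows "rk_le x z"
proof -
  have "\<forall>y z. rk_le x y \<longrightarrow> rk_le y z \<longrightarrow> rk_le x z"
  proof (rule eps_induct[where P = "\<lambda>x. \<forall>y z. rk_le x y \<longrightarrow> rk_le y z \<longrightarrow> rk_le x z"])
    show "param_def U (\<lambda>e. \<forall>y z. rk_le (e 0) y \<longrightarrow> rk_le y z \<longrightarrow> rk_le (e 0) z)"
      by (intro param_intros param_rk_le)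
    fix x assume IH: "\<And>w. w \<epsilon> x \<Longrightarrow> \<forall>y z. rk_le w y \<longrightarrow> rk_le y z \<longrightarrow> rk_le w z"
    show "\<forall>y z. rk_le x y \<longrightarrow> rk_le y z \<longrightarrow> rk_le x z"
    proof (intro allI impI)
      fix y z assume "rk_le x y" "rk_le y z"
      then show "rk_le x z" using IH rk_le[of x y] rk_le[of y z] rk_le[of x z] by blast
    qed
  qed
  then show ?thesis using assms by blast
qed

text \<open>Linearity of the rank order, in the strict form that lets \<open>rk_least\<close>
  descend to a member.\<close>

lemma rk_less: "\<not> rk_le x y \<Longrightarrow> \<exists>v. v \<epsilon> x \<and> rk_le y v"
proof -
  have "\<forall>y. rk_le x y \<or> (\<exists>v. v \<epsilon> x \<and> rk_le y v)"
  proof (rule eps_induct[where P = "\<lambda>x. \<forall>y. rk_le x y \<or> (\<exists>v. v \<epsilon> x \<and> rk_le y v)"])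
    show "param_def U (\<lambda>e. \<forall>y. rk_le (e 0) y \<or> (\<exists>v. v \<epsilon> e 0 \<and> rk_le y v))"
      by (intro param_intros param_rk_le)
    fix x assume IH: "\<And>w. w \<epsilon> x \<Longrightarrow> \<forall>y. rk_le w y \<or> (\<exists>v. v \<epsilon> w \<and> rk_le y v)"
    show "\<forall>y. rk_le x y \<or> (\<exists>v. v \<epsilon> x \<and> rk_le y v)"
    proof
      fix y
      show "rk_le x y \<or> (\<exists>v. v \<epsilon> x \<and> rk_le y v)"
      proof (cases "rk_le x y")
        case False
        then obtain v where v: "v \<epsilon> x" "\<And>y'. y' \<epsilon> y \<Longrightarrow> \<not> rk_le v y'" using rk_le[of x y] by blast
        then have "rk_le y v" using IH[OF v(1)] rk_le[of y v] by blast
        then show ?thesis using v by blast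
      qed simp
    qed
  qed
  then show "\<not> rk_le x y \<Longrightarrow> \<exists>v. v \<epsilon> x \<and> rk_le y v" by blast
qed

text \<open>Induction on an upper bound \<open>x\<close>: if \<open>z\<close> is below
  \<open>x\<close> and not least, some \<open>z'\<close> lies below a member of \<open>z\<close>,
  hence below a member of \<open>x\<close>.\<close>

lemma rk_least:
  assumes Z: "param_def U (\<lambda>e. Z (e 0))" and z: "Z z"
  shows "\<exists>z. Z z \<and> (\<forall>z'. Z z' \<longrightarrow> rk_le z z')"
proof -
  have "(\<exists>z. Z z \<and> rk_le z x) \<longrightarrow> (\<exists>z. Z z \<and> (\<forall>z'. Z z' \<longrightarrow> rk_le z z'))" for x
  proof (rule eps_induct[where P = "\<lambda>x. (\<exists>z. Z z \<and> rk_le z x) \<longrightarrow> (\<exists>z. Z z \<and> (\<forall>z'. Z z' \<longrightarrow> rk_le z z'))"])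
    show "param_def U (\<lambda>e. (\<exists>z. Z z \<and> rk_le z (e 0)) \<longrightarrow> (\<exists>z. Z z \<and> (\<forall>z'. Z z' \<longrightarrow> rk_le z z')))"
      by (intro param_imp param_ex param_and param_bool param_sub1[OF Z] param_rk_le tm_var)
    fix x assume IH: "\<And>y. y \<epsilon> x \<Longrightarrow> (\<exists>z. Z z \<and> rk_le z y) \<longrightarrow> (\<exists>z. Z z \<and> (\<forall>z'. Z z' \<longrightarrow> rk_le z z'))"
    show "(\<exists>z. Z z \<and> rk_le z x) \<longrightarrow> (\<exists>z. Z z \<and> (\<forall>z'. Z z' \<longrightarrow> rk_le z z'))"
    proof (rule impI, rule ccontr)
      assume "\<exists>z. Z z \<and> rk_le z x" and no: "\<not> (\<exists>z. Z z \<and> (\<forall>z'. Z z' \<longrightarrow> rk_le z z'))"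
      then obtain z where z: "Z z" "rk_le z x" by blast
      then obtain z' where z': "Z z'" "\<not> rk_le z z'" using no by blast
      obtain v where v: "v \<epsilon> z" "rk_le z' v" using rk_less[OF z'(2)] by blast
      obtain y where y: "y \<epsilon> x" "rk_le v y" using z(2) v(1) rk_le[of z x] by blast
      have "rk_le z' y" using rk_le_trans v(2) y(2) by blast
      then show False using IH[OF y(1)] z'(1) no by blast
    qed
  qed
  then show ?thesis using z rk_le_refl by blast
qed

text \<open>A set of rank at most that of \<open>y\<close> is a subset of the union of the levels
  for members of \<open>y\<close>. Urelements have rank zero and enter every level, which is where
  they have to form a set.\<close>

lemma small_rk_le:
  assumes A: "urelements_form_set U" shows "small (\<lambda>x. rk_le x y)"
proof -
  obtain a where a: "\<And>x. x \<epsilon> a \<longleftrightarrow> urel U x" using A unfolding urelements_form_set_def by blast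
  define R where "R y v \<longleftrightarrow> is_set U v \<and> (\<forall>x. x \<epsilon> v \<longleftrightarrow> rk_le x y)" for y v
  have R: "param_def U (\<lambda>e. R (e 0) (e (Suc 0)))" unfolding R_def by (intro param_intros param_rk_le)
  have "\<exists>v. R y v"
  proof (rule eps_induct[where P = "\<lambda>y. \<exists>v. R y v"])
    show "param_def U (\<lambda>e. \<exists>v. R (e 0) v)" by (intro param_intros param_sub2[OF R])
    fix y assume IH: "\<And>z. z \<epsilon> y \<Longrightarrow> \<exists>v. R z v"
    have "small (\<lambda>v. \<exists>z. z \<epsilon> y \<and> R z v)"
      by (rule small_image[OF R]) (auto simp: R_def intro: ext)
    then obtain V where V: "\<And>v. v \<epsilon> V \<longleftrightarrow> (\<exists>z. z \<epsilon> y \<and> R z v)" unfolding small_def by blast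
    obtain W where W: "\<And>x. x \<epsilon> W \<longleftrightarrow> (\<exists>v. x \<epsilon> v \<and> v \<epsilon> V)" using small_Union[of V] unfolding small_def by blast
    have W': "x \<epsilon> W" if z: "z \<epsilon> y" "rk_le x z" for x z
    proof -
      obtain v where v: "R z v" using IH z(1) by blast
      then have "x \<epsilon> v" "v \<epsilon> V" using z V unfolding R_def by blast+
      then show ?thesis using W by blast
    qed
    have sm: "small (\<lambda>x. (is_set U x \<and> (\<forall>z. z \<epsilon> x \<longrightarrow> z \<epsilon> W)) \<or> x \<epsilon> a)"
      by (rule small_un[OF small_Pow small_members])
    have "small (\<lambda>x. rk_le x y)"
    proof (rule small_subset)
      show "param_def U (\<lambda>e. rk_le (e 0) y)" by (intro param_rk_le tm_var tm_const)
      show "x \<epsilon> st (\<lambda>x. (is_set U x \<and> (\<forall>z. z \<epsilon> x \<longrightarrow> z \<epsilon> W)) \<or> x \<epsilon> a)" if "rk_le x y" for x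
        unfolding mem_st[OF sm] unfolding a using that W' rk_le[of x y] unfolding is_set_def by blast
    qed
    then show "\<exists>v. R y v" unfolding R_def small_def by blast
  qed
  then show ?thesis unfolding R_def small_def by blast
qed

section \<open>The abstraction map\<close>

lemma ex_abstraction:
  assumes A: "urelements_form_set U" and X: "X \<in> classes U" shows "\<exists>y. abstraction X y"
proof -
  define Q where "Q i \<longleftrightarrow> (\<exists>z. codes X (stage i) z)" for i
  have "\<exists>i. Q i" unfolding Q_def codes_iff using class_stage[OF X] by blast
  \<comment> \<open>The least stage is chosen among standard numbers, outside
    \<open>U\<close>.\<close>
  then obtain i where i: "Q i" "\<And>k. k < i \<Longrightarrow> \<not> Q k" by (metis LeastI not_less_Least)
  have row_i: "row (hist i) (num i) = stage i" for i using row_hist[of i i] by auto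
  \<comment> \<open>The witnessing table is an arbitrary class, but uniqueness of histories forces
    its row at \<open>num k\<close> to be \<open>stage k\<close>.\<close>
  have code: "has_code X (num k) \<longleftrightarrow> Q k" for k
  proof
    assume "has_code X (num k)"
    then obtain T where T: "T \<in> classes U" "history T (num k)" "\<exists>z. codes X (row T (num k)) z"
      unfolding has_code_def by blast
    have "row T (num k) = stage k"
      using history_unique[OF T(1,2) hist_class history_hist N_num] row_i by simp
    then show "Q k" using T(3) unfolding Q_def by simp
  next
    assume "Q k"
    then show "has_code X (num k)"
      unfolding has_code_def Q_def using hist_class history_hist row_i by metis
  qed
  define L where "L z \<longleftrightarrow> codes X (stage i) z \<and> (\<forall>z'. codes X (stage i) z' \<longrightarrow> rk_le z z')" for z
  have pc: "tm s \<Longrightarrow> param_def U (\<lambda>e. codes X (stage i) (s e))" for s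
    by (intro param_codes[OF X] param_stage)
  have pL: "param_def U (\<lambda>e. L (e 0))" unfolding L_def by (intro param_intros pc param_rk_le)
  obtain z where z: "codes X (stage i) z" using i(1) unfolding Q_def by blast
  have "small L"
  proof (rule small_subset[OF pL])
    show "x \<epsilon> st (\<lambda>x. rk_le x z)" if "L x" for x
      using that z unfolding mem_st[OF small_rk_le[OF A]] L_def by blast
  qed
  then obtain Z where Z: "is_set U Z" "\<And>z. z \<epsilon> Z \<longleftrightarrow> L z" unfolding small_def by blast
  have "\<forall>m. m \<epsilon> num i \<longrightarrow> \<not> has_code X m" using code i(2) unfolding mem_num by blast
  moreover have "\<exists>T\<in>classes U. history T (num i) \<and>
      (\<forall>z. z \<epsilon> Z \<longleftrightarrow> codes X (row T (num i)) z \<and> (\<forall>z'. codes X (row T (num i)) z' \<longrightarrow> rk_le z z'))"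
    by (rule bexI[OF _ hist_class[of i]]) (simp add: history_hist row_i Z(2) L_def)
  ultimately show ?thesis
    unfolding abstraction_def is_pair_iff using N_num code i(1) Z(1) by blast
qed

text \<open>Linearity of \<omega> makes the least stage unique, and any two tables share that row.
  The argument does not depend on the stage being standard.\<close>

lemma abstraction_unique:
  assumes y: "abstraction X y" and y': "abstraction X y'" shows "y = y'"
proof -
  obtain n Z T where n: "y = pr n Z" "N n" "has_code X n" "\<And>m. m \<epsilon> n \<Longrightarrow> \<not> has_code X m" "is_set U Z"
    "T \<in> classes U" "history T n"
    "\<And>z. z \<epsilon> Z \<longleftrightarrow> codes X (row T n) z \<and> (\<forall>z'. codes X (row T n) z' \<longrightarrow> rk_le z z')"
    using y unfolding abstraction_def is_pair_iff by blast
  obtain n' Z' T' where n': "y' = pr n' Z'" "N n'" "has_code X n'" "\<And>m. m \<epsilon> n' \<Longrightarrow> \<not> has_code X m" "is_set U Z'"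
    "T' \<in> classes U" "history T' n'"
    "\<And>z. z \<epsilon> Z' \<longleftrightarrow> codes X (row T' n') z \<and> (\<forall>z'. codes X (row T' n') z' \<longrightarrow> rk_le z z')"
    using y' unfolding abstraction_def is_pair_iff by blast
  have nn: "n = n'" using N_linear[OF n(2) n'(2)] n(3,4) n'(3,4) by blast
  then have "row T n = row T' n'" using history_unique[OF n(6,7) n'(6) _ n(2)] n'(7) by simp
  then have "Z = Z'" using ext[OF n(5) n'(5)] n(8) n'(8) by simp
  then show ?thesis using nn n(1) n'(1) by simp
qed

text \<open>The set \<open>Z\<close> is nonempty because some code of \<open>X\<close> at stage
  \<open>n\<close> has least rank. Such a code belongs to \<open>Z\<close>, so in the common row it
  codes \<open>Y\<close> too.\<close>

lemma abstraction_inj: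
  assumes X: "X \<in> classes U" "abstraction X y" and Y: "abstraction Y y" shows "X = Y"
proof -
  obtain n Z T where n: "y = pr n Z" "N n" "has_code X n" "T \<in> classes U" "history T n"
    "\<And>z. z \<epsilon> Z \<longleftrightarrow> codes X (row T n) z \<and> (\<forall>z'. codes X (row T n) z' \<longrightarrow> rk_le z z')"
    using X(2) unfolding abstraction_def is_pair_iff by blast
  obtain T' where n': "T' \<in> classes U" "history T' n" "\<And>z. z \<epsilon> Z \<Longrightarrow> codes Y (row T' n) z"
    using Y unfolding abstraction_def is_pair_iff n(1) pr_eq by blast
  have TT': "row T' n = row T n" by (rule history_unique[OF n'(1,2) n(4,5) n(2)])
  obtain T'' z where T'': "T'' \<in> classes U" "history T'' n" "codes X (row T'' n) z"
    using n(3) unfolding has_code_def by blast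
  then have "codes X (row T n) z" using history_unique[OF T''(1,2) n(4,5) n(2)] by simp
  moreover have "param_def U (\<lambda>e. codes X (row T n) (e 0))"
    by (intro param_codes[OF X(1)] param_row[OF n(4)] tm_const tm_var)
  ultimately obtain z where "codes X (row T n) z" "\<forall>z'. codes X (row T n) z' \<longrightarrow> rk_le z z'"
    using rk_least[of "codes X (row T n)"] by blast
  then have "codes X (row T n) z" "codes Y (row T n) z" using n(6) n'(3) TT' by auto
  then show ?thesis by (rule codes_inj)
qed

lemma law_V_if_urelements_form_set:
  assumes A: "urelements_form_set U"
  shows "\<exists>f. definable_map U f \<and> basic_law_V U f"
proof -
  define f where "f X = (THE y. abstraction X y)" for X
  have f: "f X = y \<longleftrightarrow> abstraction X y" if "X \<in> classes U" for X y
  proof -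
    have "abstraction X (f X)"
      unfolding f_def by (rule theI') (use ex_abstraction[OF A that] abstraction_unique in blast)
    then show ?thesis using abstraction_unique by blast
  qed
  have "definable_map U f" by (rule definable_mapI[OF so_abstraction f])
  moreover have "basic_law_V U f"
    unfolding basic_law_V_def using f abstraction_inj by (metis set_eqI)
  ultimately show ?thesis by blast
qed

end

theorem theorem4:
  fixes U :: "'a ustruct"
  assumes "ZFU_R U" and "DC_scheme U"
  shows "(urelements_form_set U \<longleftrightarrow> (\<exists>f. definable_map U f \<and> basic_law_V U f)) \<and>
         ((\<exists>f. definable_map U f \<and> basic_law_V U f) \<longleftrightarrow>
          (\<exists>f. param_definable_map U f \<and> basic_law_V U f))"
proof -
  interpret zfu_dc U using assms by unfold_locales
  have "UNIV \<in> classes U" unfolding classes_iff by (simp add: param_bool)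
  then have "(\<exists>f. definable_map U f \<and> basic_law_V U f) \<Longrightarrow> (\<exists>f. param_definable_map U f \<and> basic_law_V U f)"
    using definable_map_imp_param by blast
  then show ?thesis
    using law_V_if_urelements_form_set urelements_form_set_if_law_V by blast
qed

end
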